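(* Let $\overline{x}\in\mathbb{X}$ be a stationary point of the nonlinear semidefinite program (NLSDP) $\min f(x)$ s.t. $h(x)=0$, $g(x)\in\mathbb{S}^n_+$, with a Lagrange multiplier $(\overline\xi,\overline\Gamma)\in M(\overline{x})$, and let $F$ be the associated KKT residual mapping. (i) If the weak second order condition (W-SOC) and the constraint nondegeneracy hold at $(\overline x,\overline\xi,\overline\Gamma)$, then the element $\overline{\mathcal U}_0\in\partial_B F(\overline x,\overline\xi,\overline\Gamma)$ is nonsingular. (ii) If the strong second order sufficient condition (S-SOSC) and the weak strict Robinson constraint qualification (W-SRCQ) hold at $(\overline x,\overline\xi,\overline\Gamma)$, then the element $\overline{\mathcal U}_{\mathcal I}\in\partial_B F(\overline x,\overline\xi,\overline\Gamma)$ is nonsingular.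
   Context: Setting. $\mathbb{X}$ is a finite-dimensional real Euclidean space; $\mathbb{S}^n$ is the space of real symmetric $n\times n$ matrices with the trace inner product, $\mathbb{S}^n_+$ the positive semidefinite cone. The functions $f:\mathbb{X}\to\mathbb{R}$, $h:\mathbb{X}\to\mathbb{R}^m$, $g:\mathbb{X}\to\mathbb{S}^n$ are twice continuously differentiable. $L(x,\xi,\Gamma)=f(x)+\langle\xi,h(x)\rangle+\langle\Gamma,g(x)\rangle$. Put $\mathbb{Z}=\mathbb{X}\times\mathbb{R}^m\times\mathbb{S}^n$. A KKT point is $(x,\xi,\Gamma)\in\mathbb{Z}$ with $\nabla_xL(x,\xi,\Gamma)=0$, $h(x)=0$, $\Gamma\in\mathcal{N}_{\mathbb{S}^n_+}(g(x))$ (normal cone of convex analysis). $M(x)$ is the set of $(\xi,\Gamma)$ such that $(x,\xi,\Gamma)$ is a KKT point; a feasible $x$ is stationary if $M(x)\ne\emptyset$. With $\Pi_{\mathbb{S}^n_+}$ the metric projection onto $\mathbb{S}^n_+$, the KKT residual mapping $F:\mathbb{Z}\to\mathbb{Z}$ is $F(x,\xi,\Gamma)=\big(\nabla_xL(x,\xi,\Gamma),\,h(x),\,-g(x)+\Pi_{\mathbb{S}^n_+}(g(x)+\Gamma)\big)$. It is locally Lipschitz; $\partial_BF(Z)$ denotes the set of all limits of $F'(Z^k)$ with $Z^k\to Z$, $F$ differentiable at $Z^k$. A linear operator is nonsingular if it is invertible. Eigenvalue notation. Let $A=g(\overline x)+\overline\Gamma=\overline P\,\mathrm{Diag}(\overline\lambda)\overline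 P^T$ with $\overline P$ orthogonal and $\overline\lambda$ the eigenvalues in nonincreasing order; $\alpha=\{i:\overline\lambda_i>0\}$, $\beta=\{i:\overline\lambda_i=0\}$, $\gamma=\{i:\overline\lambda_i<0\}$. Let $\overline{\mathcal B}(\Delta x)=\overline P^T(g'(\overline x)\Delta x)\overline P$, and let $\overline\Xi_{ij}=\overline\lambda_i/(\overline\lambda_i-\overline\lambda_j)$ for $i\in\alpha$, $j\in\gamma$, with $\overline\Xi_{\gamma\alpha}=\overline\Xi_{\alpha\gamma}^T$. $\circ$ is the Hadamard product. Constraint conditions (equalities of subspaces of $\mathbb{R}^m\times\mathbb{S}^n$): - Constraint nondegeneracy: $(h'(\overline x),g'(\overline x))\mathbb{X}+\{0\}\times\{\overline PB\overline P^T: B\in\mathbb{S}^n,\ B_{\beta\beta}=0,B_{\beta\gamma}=0,B_{\gamma\gamma}=0\}=\mathbb{R}^m\times\mathbb{S}^n$ (the second summand is $\{0\}\times$ the largest subspace in the tangent cone $\mathcal T_{\mathbb{S}^n_+}(g(\overline x))$). - W-SRCQ: $(h'(\overline x),g'(\overline x))\mathbb{X}+\{0\}\times\{\overline PB\overline P^T:B\in\mathbb{S}^n,\ B_{\beta\gamma}=0,B_{\gamma\gamma}=0\}=\mathbb{R}^m\times\mathbb{S}^n$ (the second summand is $\{0\}\times$ the affine hull of $\mathcal T_{\mathbb{S}^n_+}(g(\overline x))\cap\overline\Gamma^\perp$). Second order conditions. Let $q(\Delta x)=\langle\Delta x,\nabla^2_{xx}L(\overline x,\overline\xi,\overline\Gamma)\Delta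 x\rangle-2\sum_{i\in\alpha}\sum_{j\in\gamma}\frac{\overline\lambda_j}{\overline\lambda_i}\overline{\mathcal B}(\Delta x)_{ij}^2$. - W-SOC: $q(\Delta x)>0$ for all nonzero $\Delta x$ with $h'(\overline x)\Delta x=0$, $\overline{\mathcal B}(\Delta x)_{\beta\beta}=0$, $\overline{\mathcal B}(\Delta x)_{\beta\gamma}=0$, $\overline{\mathcal B}(\Delta x)_{\gamma\gamma}=0$. - S-SOSC: $q(\Delta x)>0$ for all nonzero $\Delta x$ with $h'(\overline x)\Delta x=0$, $\overline{\mathcal B}(\Delta x)_{\beta\gamma}=0$, $\overline{\mathcal B}(\Delta x)_{\gamma\gamma}=0$. The elements $\overline{\mathcal U}_0,\overline{\mathcal U}_{\mathcal I}$. For $H\in\mathbb{S}^n$ put $\widetilde H=\overline P^TH\overline P$ and $$\overline{\mathcal V}_0(H)=\overline P\begin{bmatrix}\widetilde H_{\alpha\alpha}&\widetilde H_{\alpha\beta}&\overline\Xi_{\alpha\gamma}\circ\widetilde H_{\alpha\gamma}\\ \widetilde H_{\beta\alpha}&0&0\\ \overline\Xi_{\gamma\alpha}\circ\widetilde H_{\gamma\alpha}&0&0\end{bmatrix}\overline P^T,$$ and let $\overline{\mathcal V}_{\mathcal I}(H)$ be the same expression with the $\beta\beta$ block $0$ replaced by $\widetilde H_{\beta\beta}$. For $l\in\{0,\mathcal I\}$, $$\overline{\mathcal U}_l(\Delta x,\Delta\xi,\Delta\Gamma)=\big(\nabla^2_{xx}L(\overline x,\overline\xi,\overline\Gamma)\Delta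 x+h'(\overline x)^*\Delta\xi+g'(\overline x)^*\Delta\Gamma,\ h'(\overline x)\Delta x,\ -g'(\overline x)\Delta x+\overline{\mathcal V}_l(g'(\overline x)\Delta x+\Delta\Gamma)\big).$$ Both are elements of $\partial_BF(\overline x,\overline\xi,\overline\Gamma)$. *)

theory Defs
  imports "HOL-Analysis.Analysis"
begin

section \<open>The Euclidean space of real symmetric matrices\<close>

typedef 'n symmat = "{A :: real^'n^'n. transpose A = A}"
  morphisms mat_of Symmat
  by (rule exI[of _ 0]) (simp add: transpose_def vec_eq_iff)

setup_lifting type_definition_symmat

lemma transpose_mat_of [simp]: "transpose (mat_of A) = mat_of A"
  using mat_of[of A] by simp

lemma mat_of_sym: "mat_of A $ i $ j = mat_of A $ j $ i"
  using arg_cong[OF transpose_mat_of[of A], of "\<lambda>M. M $ j $ i"] by (simp add: transpose_def)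

instantiation symmat :: (finite) real_normed_vector
begin

lift_definition zero_symmat :: "'a symmat" is 0
  by (simp add: transpose_def vec_eq_iff)

lift_definition plus_symmat :: "'a symmat \<Rightarrow> 'a symmat \<Rightarrow> 'a symmat" is "(+)"
  by (simp add: transpose_def vec_eq_iff)

lift_definition minus_symmat :: "'a symmat \<Rightarrow> 'a symmat \<Rightarrow> 'a symmat" is "(-)"
  by (simp add: transpose_def vec_eq_iff)

lift_definition uminus_symmat :: "'a symmat \<Rightarrow> 'a symmat" is uminus
  by (simp add: transpose_def vec_eq_iff)

lift_definition scaleR_symmat :: "real \<Rightarrow> 'a symmat \<Rightarrow> 'a symmat" is "(*\<^sub>R)"
  by (simp add: transpose_def vec_eq_iff)

definition norm_symmat :: "'a symmat \<Rightarrow> real" where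
  "norm_symmat A = norm (mat_of A)"

definition dist_symmat :: "'a symmat \<Rightarrow> 'a symmat \<Rightarrow> real" where
  "dist_symmat A B = norm (A - B)"

definition sgn_symmat :: "'a symmat \<Rightarrow> 'a symmat" where
  "sgn_symmat A = scaleR (inverse (norm A)) A"

definition [code del]:
  "(uniformity :: ('a symmat \<times> 'a symmat) filter) =
     (INF e\<in>{0<..}. principal {(A, B). dist A B < e})"

definition open_symmat :: "'a symmat set \<Rightarrow> bool" where
  [code del]: "open_symmat U =
     (\<forall>A\<in>U. \<forall>\<^sub>F (A', B) in uniformity. A' = A \<longrightarrow> B \<in> U)"

instance
proof
  fix A B C :: "'a symmat" and a b :: real
  show "A + B + C = A + (B + C)" "A + B = B + A" "0 + A = A" "- A + A = 0" "A - B = A + - B"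
    by (transfer, simp add: algebra_simps)+
  show "a *\<^sub>R (A + B) = a *\<^sub>R A + a *\<^sub>R B" "(a + b) *\<^sub>R A = a *\<^sub>R A + b *\<^sub>R A"
    "a *\<^sub>R b *\<^sub>R A = (a * b) *\<^sub>R A" "1 *\<^sub>R A = A"
    by (transfer, simp add: algebra_simps)+
  show "norm A = 0 \<longleftrightarrow> A = 0"
    by (simp add: norm_symmat_def mat_of_inject[symmetric] zero_symmat.rep_eq)
  show "norm (A + B) \<le> norm A + norm B"
    by (simp add: norm_symmat_def plus_symmat.rep_eq norm_triangle_ineq)
  show "norm (a *\<^sub>R A) = \<bar>a\<bar> * norm A"
    by (simp add: norm_symmat_def scaleR_symmat.rep_eq)
qed (rule dist_symmat_def sgn_symmat_def uniformity_symmat_def open_symmat_def)+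

end

instantiation symmat :: (finite) real_inner
begin

definition inner_symmat :: "'a symmat \<Rightarrow> 'a symmat \<Rightarrow> real" where
  "inner A B = trace (mat_of A ** mat_of B)"

lemma inner_symmat_mat_of: "inner A B = inner (mat_of A) (mat_of B)"
  by (simp add: inner_symmat_def trace_def matrix_matrix_mult_def inner_vec_def mat_of_sym[of B])

instance
proof
  fix A B C :: "'a symmat" and a :: real
  show "inner A B = inner B A"
    by (simp add: inner_symmat_mat_of inner_commute)
  show "inner (A + B) C = inner A C + inner B C"
    by (simp add: inner_symmat_mat_of plus_symmat.rep_eq inner_add_left)
  show "inner (a *\<^sub>R A) B = a * inner A B"
    by (simp add: inner_symmat_mat_of scaleR_symmat.rep_eq)
  show "0 \<le> inner A A"
    by (simp add: inner_symmat_mat_of)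
  show "inner A A = 0 \<longleftrightarrow> A = 0"
    by (simp add: inner_symmat_mat_of mat_of_inject[symmetric] zero_symmat.rep_eq)
  show "norm A = sqrt (inner A A)"
    by (simp add: norm_symmat_def inner_symmat_mat_of norm_eq_sqrt_inner)
qed

end

lemma linear_mat_of: "linear mat_of"
  by (rule linearI) (simp_all add: plus_symmat.rep_eq scaleR_symmat.rep_eq)

lemma subspace_symmetric: "subspace {A :: real^'n^'n. transpose A = A}"
  by (auto simp: subspace_def transpose_def vec_eq_iff)

lemma ex_orthonormal_basis_symmat:
  "\<exists>B :: 'n::finite symmat set. finite B \<and> (\<forall>u\<in>B. \<forall>v\<in>B. inner u v = (if u = v then 1 else 0)) \<and>
     (\<forall>A. (\<forall>u\<in>B. inner A u = 0) \<longleftrightarrow> A = 0)"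
proof -
  let ?S = "{A :: real^'n^'n. transpose A = A}"
  obtain B where B: "B \<subseteq> ?S" "pairwise orthogonal B" "\<And>x. x \<in> B \<Longrightarrow> norm x = 1"
    "independent B" "card B = dim ?S" "span B = ?S"
  proof (rule orthonormal_basis_subspace[OF subspace_symmetric])
    fix B :: "(real^'n^'n) set"
    assume "B \<subseteq> ?S" "pairwise orthogonal B" "\<And>x. x \<in> B \<Longrightarrow> norm x = 1"
      "independent B" "card B = dim ?S" "span B = ?S"
    then show thesis by (rule that)
  qed
  have fin: "finite B"
    by (rule independent_imp_finite[OF B(4)])
  let ?C = "Symmat ` B"
  have rep: "mat_of (Symmat u) = u" if "u \<in> B" for u
    using subsetD[OF B(1) that] by (rule Symmat_inverse)
  have on: "inner u v = (if u = v then 1 else 0)" if u: "u \<in> ?C" and v: "v \<in> ?C" for u v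
  proof -
    obtain u' where u': "u' \<in> B" "u = Symmat u'" using u by (rule imageE) blast
    obtain v' where v': "v' \<in> B" "v = Symmat v'" using v by (rule imageE) blast
    show ?thesis
    proof (cases "u' = v'")
      case True
      have "inner u' u' = 1"
        unfolding dot_square_norm B(3)[OF u'(1)] by (rule power_one)
      then show ?thesis
        using True u' v' rep[OF u'(1)] by (simp only: inner_symmat_mat_of if_True simp_thms)
    next
      case False
      have "inner u' v' = 0"
        using pairwiseD[OF B(2) u'(1) v'(1) False] by (simp only: orthogonal_def)
      moreover have "u \<noteq> v"
      proof
        assume "u = v"
        then have "mat_of (Symmat u') = mat_of (Symmat v')" using u'(2) v'(2) by (simp only:)
        then show False using False by (simp only: rep[OF u'(1)] rep[OF v'(1)])
      qed
      ultimately show ?thesis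
        using u' v' rep[OF u'(1)] rep[OF v'(1)] by (simp only: inner_symmat_mat_of if_False simp_thms)
    qed
  qed
  have zero: "A = 0" if A: "\<forall>u\<in>?C. inner A u = 0" for A :: "'n symmat"
  proof -
    have *: "orthogonal (mat_of A) u" if "u \<in> B" for u
      using bspec[OF A imageI[OF that]] rep[OF that]
      by (simp only: orthogonal_def inner_symmat_mat_of)
    have "mat_of A \<in> span B"
      unfolding B(6) by (rule mat_of)
    then have "orthogonal (mat_of A) (mat_of A)"
      using * by (rule orthogonal_to_span)
    then have "inner A A = 0"
      by (simp only: orthogonal_def inner_symmat_mat_of)
    then show ?thesis by (simp only: inner_eq_zero_iff)
  qed
  have "finite ?C \<and> (\<forall>u\<in>?C. \<forall>v\<in>?C. inner u v = (if u = v then 1 else 0)) \<and>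
     (\<forall>A. (\<forall>u\<in>?C. inner A u = 0) \<longleftrightarrow> A = 0)"
    apply (intro conjI ballI allI iffI)
       apply (rule finite_imageI[OF fin])
      apply (erule (1) on)
     apply (erule zero)
    apply (simp only: inner_zero_left)
    done
  then show ?thesis by (rule exI)
qed

instantiation symmat :: (finite) euclidean_space
begin

definition Basis_symmat :: "'a symmat set" where
  "Basis_symmat = (SOME B. finite B \<and> (\<forall>u\<in>B. \<forall>v\<in>B. inner u v = (if u = v then 1 else 0)) \<and>
     (\<forall>A. (\<forall>u\<in>B. inner A u = 0) \<longleftrightarrow> A = 0))"

instance
proof
  have *: "finite (Basis :: 'a symmat set) \<and>
      (\<forall>u\<in>Basis. \<forall>v\<in>Basis. inner u (v :: 'a symmat) = (if u = v then 1 else 0)) \<and>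
      (\<forall>A :: 'a symmat. (\<forall>u\<in>Basis. inner A u = 0) \<longleftrightarrow> A = 0)"
    unfolding Basis_symmat_def by (rule someI_ex[OF ex_orthonormal_basis_symmat])
  have all0: "(\<forall>u\<in>Basis. inner A u = 0) \<longleftrightarrow> A = 0" for A :: "'a symmat"
    by (rule spec[OF conjunct2[OF conjunct2[OF *]]])
  show "finite (Basis :: 'a symmat set)"
    by (rule conjunct1[OF *])
  show "inner u v = (if u = v then 1 else 0)" if "u \<in> Basis" "v \<in> Basis" for u v :: "'a symmat"
    by (rule bspec[OF bspec[OF conjunct1[OF conjunct2[OF *]] that(1)] that(2)])
  show "(\<forall>u\<in>Basis. inner A u = 0) \<longleftrightarrow> A = 0" for A :: "'a symmat"
    by (rule all0)
  show "(Basis :: 'a symmat set) \<noteq> {}"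
  proof
    assume "(Basis :: 'a symmat set) = {}"
    then have "Symmat (mat 1) = (0 :: 'a symmat)"
      using all0[of "Symmat (mat 1)"] by simp
    then have "mat_of (Symmat (mat 1) :: 'a symmat) = 0"
      by (simp only: zero_symmat.rep_eq)
    then have "(mat 1 :: real^'a^'a) = 0"
      by (simp add: Symmat_inverse transpose_mat)
    then have "(mat 1 :: real^'a^'a) $ undefined $ undefined = 0"
      by (simp only: zero_index)
    then show False
      by (simp add: mat_def)
  qed
qed

end

lift_definition sym_diag :: "real^'n \<Rightarrow> 'n::finite symmat" is
  "\<lambda>l. \<chi> i j. if i = j then l $ i else 0"
  by (simp add: transpose_def vec_eq_iff)

lift_definition sym_congr :: "real^'n^'n \<Rightarrow> 'n::finite symmat \<Rightarrow> 'n symmat" is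
  "\<lambda>P B. P ** B ** transpose P"
  by (simp add: matrix_transpose_mul matrix_mul_assoc)

definition block_zero :: "'n set \<Rightarrow> 'n set \<Rightarrow> 'n::finite symmat \<Rightarrow> bool" where
  "block_zero I J B \<longleftrightarrow> (\<forall>i\<in>I. \<forall>j\<in>J. mat_of B $ i $ j = 0)"

definition psd_cone :: "'n::finite symmat set" where
  "psd_cone = {A. \<forall>v. 0 \<le> inner v (mat_of A *v v)}"


section \<open>Variational analysis\<close>

text \<open>The normal cone of convex analysis; it is empty at points outside the set.\<close>

definition normal_cone :: "'a::real_inner set \<Rightarrow> 'a \<Rightarrow> 'a set" where
  "normal_cone K y = {v. y \<in> K \<and> (\<forall>z\<in>K. inner v (z - y) \<le> 0)}"

definition gradient :: "('a::real_inner \<Rightarrow> real) \<Rightarrow> 'a \<Rightarrow> 'a" where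
  "gradient f x = (THE D. GDERIV f x :> D)"

definition twice_cont_diff :: "('a::real_normed_vector \<Rightarrow> 'b::real_normed_vector) \<Rightarrow> bool" where
  "twice_cont_diff f \<longleftrightarrow>
     (\<exists>(f' :: 'a \<Rightarrow> 'a \<Rightarrow>\<^sub>L 'b) (f'' :: 'a \<Rightarrow> 'a \<Rightarrow>\<^sub>L 'a \<Rightarrow>\<^sub>L 'b).
        (\<forall>x. (f has_derivative blinfun_apply (f' x)) (at x)) \<and>
        (\<forall>x. (f' has_derivative blinfun_apply (f'' x)) (at x)) \<and>
        continuous_on UNIV f'')"

text \<open>Derivatives are taken as elements of the normed space of bounded linear maps, so that
  limits of Jacobians are limits in the operator norm.\<close>

definition B_subdiff :: "('a::real_normed_vector \<Rightarrow> 'b::real_normed_vector) \<Rightarrow> 'a \<Rightarrow> ('a \<Rightarrow> 'b) set" where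
  "B_subdiff F z = {blinfun_apply V | V.
     \<exists>(zs :: nat \<Rightarrow> 'a) (Vs :: nat \<Rightarrow> 'a \<Rightarrow>\<^sub>L 'b). zs \<longlonglongrightarrow> z \<and>
       (\<forall>k. (F has_derivative blinfun_apply (Vs k)) (at (zs k))) \<and> Vs \<longlonglongrightarrow> V}"

definition nonsingular :: "('a::real_vector \<Rightarrow> 'a) \<Rightarrow> bool" where
  "nonsingular U \<longleftrightarrow> linear U \<and> bij U"


section \<open>The nonlinear semidefinite program\<close>

context
  fixes f :: "'a::euclidean_space \<Rightarrow> real"
    and h :: "'a \<Rightarrow> real^'m"
    and g :: "'a \<Rightarrow> 'n::finite symmat"
begin

definition lagrangian :: "'a \<Rightarrow> real^'m \<Rightarrow> 'n symmat \<Rightarrow> real" where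
  "lagrangian x \<xi> \<Gamma> = f x + inner \<xi> (h x) + inner \<Gamma> (g x)"

definition grad_lagrangian :: "'a \<Rightarrow> real^'m \<Rightarrow> 'n symmat \<Rightarrow> 'a" where
  "grad_lagrangian x \<xi> \<Gamma> = gradient (\<lambda>y. lagrangian y \<xi> \<Gamma>) x"

definition hess_lagrangian :: "'a \<Rightarrow> real^'m \<Rightarrow> 'n symmat \<Rightarrow> 'a \<Rightarrow> 'a" where
  "hess_lagrangian x \<xi> \<Gamma> = frechet_derivative (\<lambda>y. grad_lagrangian y \<xi> \<Gamma>) (at x)"

definition kkt_point :: "'a \<Rightarrow> real^'m \<Rightarrow> 'n symmat \<Rightarrow> bool" where
  "kkt_point x \<xi> \<Gamma> \<longleftrightarrow>
     grad_lagrangian x \<xi> \<Gamma> = 0 \<and> h x = 0 \<and> \<Gamma> \<in> normal_cone psd_cone (g x)"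

definition multipliers :: "'a \<Rightarrow> ((real^'m) \<times> 'n symmat) set" where
  "multipliers x = {(\<xi>, \<Gamma>). kkt_point x \<xi> \<Gamma>}"

definition stationary :: "'a \<Rightarrow> bool" where
  "stationary x \<longleftrightarrow> h x = 0 \<and> g x \<in> psd_cone \<and> multipliers x \<noteq> {}"

definition kkt_residual :: "'a \<times> (real^'m) \<times> 'n symmat \<Rightarrow> 'a \<times> (real^'m) \<times> 'n symmat" where
  "kkt_residual = (\<lambda>(x, \<xi>, \<Gamma>).
     (grad_lagrangian x \<xi> \<Gamma>, h x, - g x + closest_point psd_cone (g x + \<Gamma>)))"

end


section \<open>Eigenvalue data, constraint qualifications and second order conditions\<close>

definition spectral_decomp ::
    "real^'n::{finite,linorder}^'n::_ \<Rightarrow> real^'n::_ \<Rightarrow> 'n symmat \<Rightarrow> bool" where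
  "spectral_decomp P \<mu> A \<longleftrightarrow> orthogonal_matrix P \<and> (\<forall>i j. i \<le> j \<longrightarrow> \<mu> $ j \<le> \<mu> $ i) \<and>
     A = sym_congr P (sym_diag \<mu>)"

text \<open>With \<open>\<mu>\<close> the vector of eigenvalues of $g(x) + \Gamma$, the index sets $\alpha$, $\beta$,
  $\gamma$ are \<open>idx_pos \<mu>\<close>, \<open>idx_zero \<mu>\<close>, \<open>idx_neg \<mu>\<close>.\<close>

definition idx_pos :: "real^'n \<Rightarrow> 'n::finite set" where
  "idx_pos \<mu> = {i. \<mu> $ i > 0}"

definition idx_zero :: "real^'n \<Rightarrow> 'n::finite set" where
  "idx_zero \<mu> = {i. \<mu> $ i = 0}"

definition idx_neg :: "real^'n \<Rightarrow> 'n::finite set" where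
  "idx_neg \<mu> = {i. \<mu> $ i < 0}"

context
  fixes f :: "'a::euclidean_space \<Rightarrow> real"
    and h :: "'a \<Rightarrow> real^'m"
    and g :: "'a \<Rightarrow> 'n::finite symmat"
    and P :: "real^'n^'n" and \<mu> :: "real^'n"
    and x :: 'a and \<xi> :: "real^'m" and \<Gamma> :: "'n symmat"
begin

definition constraint_nondegenerate :: bool where
  "constraint_nondegenerate \<longleftrightarrow>
     {u + v | u v.
        u \<in> range (\<lambda>d. (frechet_derivative h (at x) d, frechet_derivative g (at x) d)) \<and>
        v \<in> {0} \<times> {sym_congr P B | B. block_zero (idx_zero \<mu>) (idx_zero \<mu>) B \<and>
          block_zero (idx_zero \<mu>) (idx_neg \<mu>) B \<and> block_zero (idx_neg \<mu>) (idx_neg \<mu>) B}} = UNIV"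

definition W_SRCQ :: bool where
  "W_SRCQ \<longleftrightarrow>
     {u + v | u v.
        u \<in> range (\<lambda>d. (frechet_derivative h (at x) d, frechet_derivative g (at x) d)) \<and>
        v \<in> {0} \<times> {sym_congr P B | B.
          block_zero (idx_zero \<mu>) (idx_neg \<mu>) B \<and> block_zero (idx_neg \<mu>) (idx_neg \<mu>) B}} = UNIV"

definition rotated_dg :: "'a \<Rightarrow> 'n symmat" where
  "rotated_dg d = sym_congr (transpose P) (frechet_derivative g (at x) d)"

definition second_order_form :: "'a \<Rightarrow> real" where
  "second_order_form d = inner d (hess_lagrangian f h g x \<xi> \<Gamma> d) -
     2 * (\<Sum>i\<in>idx_pos \<mu>. \<Sum>j\<in>idx_neg \<mu>. \<mu> $ j / \<mu> $ i * (mat_of (rotated_dg d) $ i $ j)\<^sup>2)"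

definition W_SOC :: bool where
  "W_SOC \<longleftrightarrow> (\<forall>d. d \<noteq> 0 \<and> frechet_derivative h (at x) d = 0 \<and>
     block_zero (idx_zero \<mu>) (idx_zero \<mu>) (rotated_dg d) \<and>
     block_zero (idx_zero \<mu>) (idx_neg \<mu>) (rotated_dg d) \<and>
     block_zero (idx_neg \<mu>) (idx_neg \<mu>) (rotated_dg d) \<longrightarrow> second_order_form d > 0)"

definition S_SOSC :: bool where
  "S_SOSC \<longleftrightarrow> (\<forall>d. d \<noteq> 0 \<and> frechet_derivative h (at x) d = 0 \<and>
     block_zero (idx_zero \<mu>) (idx_neg \<mu>) (rotated_dg d) \<and>
     block_zero (idx_neg \<mu>) (idx_neg \<mu>) (rotated_dg d) \<longrightarrow> second_order_form d > 0)"

end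


section \<open>The two elements of the B-subdifferential\<close>

text \<open>\<open>V_weight \<mu> c\<close> collects the factors by which the entries of $P^T H P$ are multiplied:
  $1$ on the $\alpha\alpha$, $\alpha\beta$ and $\beta\alpha$ blocks, $\Xi$ on the $\alpha\gamma$ and
  $\gamma\alpha$ blocks, $c$ on the $\beta\beta$ block and $0$ elsewhere. The operators $V_0$ and
  $V_I$ are obtained for $c = 0$ and $c = 1$.\<close>

definition V_weight :: "real^'n \<Rightarrow> real \<Rightarrow> 'n::finite \<Rightarrow> 'n \<Rightarrow> real" where
  "V_weight \<mu> c i j =
     (if i \<in> idx_pos \<mu> \<and> j \<in> idx_pos \<mu> then 1
      else if i \<in> idx_pos \<mu> \<and> j \<in> idx_zero \<mu> then 1
      else if i \<in> idx_zero \<mu> \<and> j \<in> idx_pos \<mu> then 1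
      else if i \<in> idx_pos \<mu> \<and> j \<in> idx_neg \<mu> then \<mu> $ i / (\<mu> $ i - \<mu> $ j)
      else if i \<in> idx_neg \<mu> \<and> j \<in> idx_pos \<mu> then \<mu> $ j / (\<mu> $ j - \<mu> $ i)
      else if i \<in> idx_zero \<mu> \<and> j \<in> idx_zero \<mu> then c
      else 0)"

lemma V_weight_commute: "V_weight \<mu> c i j = V_weight \<mu> c j i"
  by (cases "\<mu> $ i" "0::real" rule: linorder_cases; cases "\<mu> $ j" "0::real" rule: linorder_cases)
     (simp_all add: V_weight_def idx_pos_def idx_zero_def idx_neg_def)

definition hadamard_V :: "real^'n \<Rightarrow> real \<Rightarrow> 'n::finite symmat \<Rightarrow> 'n symmat" where
  "hadamard_V \<mu> c H = Symmat (\<chi> i j. V_weight \<mu> c i j * mat_of H $ i $ j)"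

lemma mat_of_hadamard_V:
  "mat_of (hadamard_V \<mu> c H) = (\<chi> i j. V_weight \<mu> c i j * mat_of H $ i $ j)"
  unfolding hadamard_V_def
proof (rule Symmat_inverse, clarify)
  have "V_weight \<mu> c j i * mat_of H $ j $ i = V_weight \<mu> c i j * mat_of H $ i $ j" for i j
    by (subst V_weight_commute, subst mat_of_sym) (rule refl)
  then show "transpose (\<chi> i j. V_weight \<mu> c i j * mat_of H $ i $ j) =
      (\<chi> i j. V_weight \<mu> c i j * mat_of H $ i $ j)"
    unfolding transpose_def by (simp add: vec_eq_iff)
qed

definition op_V :: "real^'n^'n \<Rightarrow> real^'n \<Rightarrow> real \<Rightarrow> 'n::finite symmat \<Rightarrow> 'n symmat" where
  "op_V P \<mu> c H = sym_congr P (hadamard_V \<mu> c (sym_congr (transpose P) H))"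

context
  fixes f :: "'a::euclidean_space \<Rightarrow> real"
    and h :: "'a \<Rightarrow> real^'m"
    and g :: "'a \<Rightarrow> 'n::finite symmat"
    and P :: "real^'n^'n" and \<mu> :: "real^'n"
    and x :: 'a and \<xi> :: "real^'m" and \<Gamma> :: "'n symmat"
begin

definition op_U :: "real \<Rightarrow> 'a \<times> (real^'m) \<times> 'n symmat \<Rightarrow> 'a \<times> (real^'m) \<times> 'n symmat" where
  "op_U c = (\<lambda>(dx, d\<xi>, d\<Gamma>).
     (hess_lagrangian f h g x \<xi> \<Gamma> dx + adjoint (frechet_derivative h (at x)) d\<xi> +
        adjoint (frechet_derivative g (at x)) d\<Gamma>,
      frechet_derivative h (at x) dx,
      - frechet_derivative g (at x) dx + op_V P \<mu> c (frechet_derivative g (at x) dx + d\<Gamma>)))"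

definition U_0 :: "'a \<times> (real^'m) \<times> 'n symmat \<Rightarrow> 'a \<times> (real^'m) \<times> 'n symmat" where
  "U_0 = op_U 0"

definition U_I :: "'a \<times> (real^'m) \<times> 'n symmat \<Rightarrow> 'a \<times> (real^'m) \<times> 'n symmat" where
  "U_I = op_U 1"

end

end

theory Submission
  imports Defs
begin

text \<open>The projection \<open>Y\<close> of \<open>A\<close> onto the semidefinite cone satisfies \<open>Y (Y - A) = 0\<close>. Expanding
  this identity around a nonsingular diagonal matrix, and using that the projection is nonexpansive,
  the increments solve \<open>(y\<^sub>i + w\<^sub>j) E\<^sub>i\<^sub>j = y\<^sub>i H\<^sub>i\<^sub>j + O(\<parallel>H\<parallel>\<^sup>2)\<close>, where \<open>y\<close> and \<open>w\<close> are the positive and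
  negative parts of the eigenvalues. So the projection is differentiable at every nonsingular
  matrix, with a Hadamard multiplier as derivative. Perturbing \<open>\<Gamma>\<close> so that the zero eigenvalues
  of \<open>g(x) + \<Gamma>\<close> become \<open>\<plusminus>\<epsilon>\<close> exhibits both operators as limits of Jacobians.

  For nonsingularity, a kernel element \<open>(d, \<eta>, \<Theta>)\<close> satisfies \<open>q(d) = 0\<close> and \<open>d\<close> is admissible in the
  second order condition, so \<open>d = 0\<close>. What remains is \<open>h'(x)\<^sup>* \<eta> + g'(x)\<^sup>* \<Theta> = 0\<close> with \<open>\<Theta>\<close> orthogonal
  to the subspace in the constraint condition; decomposing \<open>(\<eta>, \<Theta>)\<close> accordingly shows that it is
  orthogonal to itself.\<close>

section \<open>Symmetric matrices and the projection onto the semidefinite cone\<close>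

lemma matrix_add_rdistrib: "((A :: real^'n^'m) + B) ** C = A ** C + B ** C"
  by (simp add: matrix_matrix_mult_def vec_eq_iff distrib_right sum.distrib)

lemma inner_matrix_mult_left:
  fixes A C :: "real^'n^'n"
  shows "inner A (C ** B) = inner (A ** transpose B) C"
proof -
  have "inner A (C ** B) = (\<Sum>i\<in>UNIV. \<Sum>j\<in>UNIV. \<Sum>k\<in>UNIV. A$i$j * (C$i$k * B$k$j))"
    by (simp add: inner_vec_def matrix_matrix_mult_def sum_distrib_left)
  also have "\<dots> = (\<Sum>i\<in>UNIV. \<Sum>k\<in>UNIV. \<Sum>j\<in>UNIV. A$i$j * (C$i$k * B$k$j))"
    by (intro sum.cong refl sum.swap)
  also have "\<dots> = inner (A ** transpose B) C"
    by (simp add: inner_vec_def matrix_matrix_mult_def sum_distrib_left sum_distrib_right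
        transpose_def mult_ac)
  finally show ?thesis .
qed

lemma inner_transpose: "inner (transpose A) (transpose B) = inner A (B :: real^'n^'m)"
  unfolding inner_vec_def transpose_def by (simp, rule sum.swap)

lemma inner_matrix_mult_right:
  fixes A C :: "real^'n^'n"
  shows "inner A (B ** C) = inner (transpose B ** A) C"
proof -
  have "inner A (B ** C) = inner (transpose A) (transpose C ** transpose B)"
    by (metis inner_transpose matrix_transpose_mul)
  also have "\<dots> = inner (transpose A ** B) (transpose C)"
    by (simp add: inner_matrix_mult_left)
  also have "\<dots> = inner (transpose B ** A) C"
    by (metis inner_transpose matrix_transpose_mul transpose_transpose)
  finally show ?thesis .
qed

lemma inner_symmat_sum:
  "inner A B = (\<Sum>i\<in>UNIV. \<Sum>j\<in>UNIV. mat_of A $ i $ j * mat_of B $ i $ j)"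
  by (simp add: inner_symmat_mat_of inner_vec_def)

lemma abs_mat_of_le_norm: "\<bar>mat_of A $ i $ j\<bar> \<le> norm A"
  unfolding norm_symmat_def
  by (meson component_le_norm_cart order_trans norm_nth_le real_norm_def Finite_Cartesian_Product.norm_nth_le)

lemma norm_symmat_le_sum: "norm A \<le> (\<Sum>i\<in>UNIV. \<Sum>j\<in>UNIV. \<bar>mat_of A $ i $ j\<bar>)"
proof -
  have "norm (mat_of A) \<le> (\<Sum>i\<in>UNIV. norm (mat_of A $ i))"
    unfolding norm_vec_def by (rule L2_set_le_sum) simp
  also have "\<dots> \<le> (\<Sum>i\<in>UNIV. \<Sum>j\<in>UNIV. \<bar>mat_of A $ i $ j\<bar>)"
    by (intro sum_mono norm_le_l1_cart)
  finally show ?thesis by (simp add: norm_symmat_def)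
qed

lemma symmat_eqI: "(\<And>i j. mat_of A $ i $ j = mat_of B $ i $ j) \<Longrightarrow> A = B"
  by (simp add: mat_of_inject[symmetric] vec_eq_iff)

lemma linear_sym_congr: "linear (sym_congr P)"
proof (rule linearI)
  fix A B :: "'a symmat" and r :: real
  show "sym_congr P (A + B) = sym_congr P A + sym_congr P B"
    by transfer (simp add: matrix_add_ldistrib matrix_add_rdistrib)
  show "sym_congr P (r *\<^sub>R A) = r *\<^sub>R sym_congr P A"
    by transfer (simp add: scalar_matrix_assoc[symmetric] matrix_scalar_ac)
qed

lemmas sym_congr_add = linear_add[OF linear_sym_congr]
  and sym_congr_diff = linear_diff[OF linear_sym_congr]
  and sym_congr_scaleR = linear_scale[OF linear_sym_congr]

lemma sym_congr_sym_congr: "sym_congr P (sym_congr Q A) = sym_congr (P ** Q) A"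
  by transfer (simp add: matrix_transpose_mul matrix_mul_assoc)

lemma sym_congr_mat_1: "sym_congr (mat 1) A = A"
  by transfer (simp add: transpose_mat)

lemma sym_congr_inverse:
  assumes "orthogonal_matrix P"
  shows "sym_congr (transpose P) (sym_congr P A) = A"
    and "sym_congr P (sym_congr (transpose P) A) = A"
  using assms by (simp_all add: sym_congr_sym_congr sym_congr_mat_1 orthogonal_matrix_def)

lemma sym_congr_orthogonal_eq_iff:
  assumes "orthogonal_matrix P"
  shows "sym_congr P A = B \<longleftrightarrow> A = sym_congr (transpose P) B"
  using sym_congr_inverse[OF assms] by metis

text \<open>Moving the factors across the trace product. For orthogonal \<open>P\<close> this makes
  the congruence an isometry, so the projection and the kernel equations can be studied in the
  eigenbasis.\<close>

lemma inner_sym_congr: "inner (sym_congr P A) B = inner A (sym_congr (transpose P) B)"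
proof -
  have "inner (mat_of A) (transpose P ** mat_of B ** P) =
      inner (mat_of A ** transpose P) (transpose P ** mat_of B)"
    by (simp add: inner_matrix_mult_left)
  also have "\<dots> = inner (P ** mat_of A ** transpose P) (mat_of B)"
    by (simp add: inner_matrix_mult_right matrix_mul_assoc)
  finally show ?thesis
    by (simp add: inner_symmat_mat_of sym_congr.rep_eq)
qed

section \<open>Convex geometry of the semidefinite cone\<close>

lemma sym_congr_psd:
  assumes "A \<in> psd_cone"
  shows "sym_congr P A \<in> psd_cone"
proof -
  have "inner v (mat_of (sym_congr P A) *v v) =
      inner (transpose P *v v) (mat_of A *v (transpose P *v v))" for v
    by (metis sym_congr.rep_eq matrix_vector_mul_assoc dot_lmul_matrix transpose_matrix_vector)
  then show ?thesis
    using assms by (simp add: psd_cone_def)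
qed

lemma convex_psd_cone: "convex psd_cone"
  unfolding psd_cone_def convex_def
  by (auto simp: plus_symmat.rep_eq scaleR_symmat.rep_eq matrix_vector_mult_add_rdistrib
      inner_add_right scaleR_matrix_vector_assoc[symmetric])

lemma closed_psd_cone: "closed psd_cone"
proof -
  have "continuous_on UNIV (\<lambda>A. inner v (mat_of A *v v))" for v :: "real^'a"
  proof (rule linear_continuous_on, rule linear_conv_bounded_linear[THEN iffD1], rule linearI)
  qed (simp_all add: plus_symmat.rep_eq scaleR_symmat.rep_eq matrix_vector_mult_add_rdistrib
      inner_add_right scaleR_matrix_vector_assoc[symmetric])
  then have "closed {A. 0 \<le> inner v (mat_of A *v v)}" for v :: "real^'a"
    by (intro closed_Collect_le continuous_on_const)
  then show ?thesis
    unfolding psd_cone_def by (rule closed_Collect_all)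
qed

lemma zero_psd: "0 \<in> psd_cone"
  by (simp add: psd_cone_def zero_symmat.rep_eq)

text \<open>Testing the inequality of \<open>y\<close> at the closest point and that of the closest
  point at \<open>y\<close>, then adding, bounds their squared distance by zero.\<close>

lemma closest_point_eqI:
  fixes K :: "'a::euclidean_space set"
  assumes "convex K" "closed K" "y \<in> K" and vi: "\<And>z. z \<in> K \<Longrightarrow> inner (a - y) (z - y) \<le> 0"
  shows "closest_point K a = y"
proof -
  let ?p = "closest_point K a"
  have "?p \<in> K"
    using assms by (intro closest_point_in_set) auto
  then have "inner (a - y) (?p - y) \<le> 0" by (rule vi)
  moreover have "inner (a - ?p) (y - ?p) \<le> 0"
    using assms by (intro closest_point_dot)
  ultimately have "inner (?p - y) (?p - y) \<le> 0"
    by (simp add: inner_diff_left inner_diff_right inner_commute)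
  then have "inner (?p - y) (?p - y) = 0"
    using inner_ge_zero[of "?p - y"] by linarith
  then show ?thesis
    by simp
qed

section \<open>The metric projection onto the cone\<close>

abbreviation psd_proj :: "'n::finite symmat \<Rightarrow> 'n symmat" where
  "psd_proj \<equiv> closest_point psd_cone"

lemma psd_proj_in: "psd_proj A \<in> psd_cone"
  using zero_psd by (intro closest_point_in_set closed_psd_cone) auto

lemma psd_proj_vi: "Z \<in> psd_cone \<Longrightarrow> inner (A - psd_proj A) (Z - psd_proj A) \<le> 0"
  by (intro closest_point_dot convex_psd_cone closed_psd_cone)

lemma psd_proj_nonexpansive: "norm (psd_proj A - psd_proj B) \<le> norm (A - B)"
  using closest_point_lipschitz[OF convex_psd_cone closed_psd_cone, of A B] zero_psd
  by (auto simp: dist_norm)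

text \<open>An orthogonal congruence is an isometry preserving the cone, so the variational
  inequality is pulled back by \<open>transpose P\<close> to the one at \<open>A\<close>.\<close>

lemma psd_proj_sym_congr:
  assumes "orthogonal_matrix P"
  shows "psd_proj (sym_congr P A) = sym_congr P (psd_proj A)"
proof (rule closest_point_eqI[OF convex_psd_cone closed_psd_cone])
  show "sym_congr P (psd_proj A) \<in> psd_cone"
    by (intro sym_congr_psd psd_proj_in)
  fix Z :: "'a symmat" assume "Z \<in> psd_cone"
  then have "sym_congr (transpose P) Z \<in> psd_cone"
    by (rule sym_congr_psd)
  then have "inner (A - psd_proj A) (sym_congr (transpose P) Z - psd_proj A) \<le> 0"
    by (rule psd_proj_vi)
  then show "inner (sym_congr P A - sym_congr P (psd_proj A)) (Z - sym_congr P (psd_proj A)) \<le> 0"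
    by (simp add: sym_congr_diff[symmetric] inner_sym_congr)
      (simp add: sym_congr_diff sym_congr_inverse[OF assms])
qed

lemma quadratic_nonneg_imp_linear_zero:
  fixes a b :: real
  assumes "\<And>t. 0 \<le> t * a + t\<^sup>2 * b"
  shows "a = 0"
proof (rule ccontr)
  assume a: "a \<noteq> 0"
  define c where "c = \<bar>b\<bar> + 1"
  have c: "c > 0" "b < c" unfolding c_def by auto
  \<comment> \<open>Since \<open>c\<close> exceeds \<open>b\<close>, a step of size
    \<open>a / c\<close> against the slope is short enough for the linear term to beat the quadratic
    one.\<close>
  have "(- a / c) * a + (- a / c)\<^sup>2 * b = (a / c)\<^sup>2 * (b - c)"
    using c by (simp add: field_simps power2_eq_square)
  also have "\<dots> < 0"
    using a c by (intro mult_pos_neg) auto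
  finally show False
    using assms[of "- a / c"] by simp
qed

text \<open>With \<open>W = Y - A\<close>, comparing \<open>Y\<close> with the feasible points
  \<open>(I + t C) Y (I + t C)\<^sup>T\<close> and letting \<open>t\<close> take both signs gives
  \<open>\<langle>W, C Y + Y C\<^sup>T\<rangle> = 0\<close>; the choice \<open>C = W Y\<close> then yields \<open>W Y = 0\<close>
  without a spectral decomposition.\<close>

lemma psd_proj_complementary:
  "mat_of (psd_proj A - A) ** mat_of (psd_proj A) = 0"
proof -
  define Y where "Y = psd_proj A"
  define W where "W = Y - A"
  have Y: "Y \<in> psd_cone" unfolding Y_def by (rule psd_proj_in)
  have vi: "0 \<le> inner W (Z - Y)" if "Z \<in> psd_cone" for Z
    using psd_proj_vi[OF that, of A] unfolding W_def Y_def[symmetric]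
    by (simp add: inner_diff_left)
  define C where "C = mat_of W ** mat_of Y"
  define E where "E = Symmat (C ** mat_of Y + mat_of Y ** transpose C)"
  have E: "mat_of E = C ** mat_of Y + mat_of Y ** transpose C"
    unfolding E_def
    by (rule Symmat_inverse) (simp add: matrix_transpose_mul transpose_def vec_eq_iff
      matrix_matrix_mult_def mat_of_sym mult.commute add.commute)
  have "0 \<le> t * inner W E + t\<^sup>2 * inner W (sym_congr C Y)" for t
  proof -
    \<comment> \<open>Congruence by any matrix, orthogonal or not, preserves the cone, so these are
      feasible competitors for every real \<open>t\<close>.\<close>
    have "sym_congr (mat 1 + t *\<^sub>R C) Y = Y + t *\<^sub>R E + t\<^sup>2 *\<^sub>R sym_congr C Y"
    proof -
      have "transpose (mat 1 + t *\<^sub>R C) = mat 1 + t *\<^sub>R transpose C"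
        by (simp add: transpose_def mat_def vec_eq_iff)
      then have "mat_of (sym_congr (mat 1 + t *\<^sub>R C) Y) =
          mat_of Y + t *\<^sub>R (C ** mat_of Y + mat_of Y ** transpose C)
          + t\<^sup>2 *\<^sub>R (C ** mat_of Y ** transpose C)"
        unfolding sym_congr.rep_eq
        by (simp add: matrix_add_ldistrib matrix_add_rdistrib scaleR_add_right power2_eq_square
          scalar_matrix_assoc[symmetric] matrix_scalar_ac matrix_mul_assoc)
      then show ?thesis
        by (simp add: mat_of_inject[symmetric] plus_symmat.rep_eq scaleR_symmat.rep_eq E
          sym_congr.rep_eq)
    qed
    then show ?thesis
      using vi[OF sym_congr_psd[OF Y, of "mat 1 + t *\<^sub>R C"]] by (simp add: inner_add_right)
  qed
  then have "inner W E = 0"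
    by (rule quadratic_nonneg_imp_linear_zero)
  \<comment> \<open>Here the choice of \<open>C\<close> pays off: moving \<open>Y\<close> to the
    other side turns \<open>W\<close> into \<open>C\<close> itself, and the transposed summand
    contributes the same.\<close>
  moreover have "inner W E = 2 * inner C C"
  proof -
    have "inner (mat_of W) (C ** mat_of Y) = inner C C"
      by (simp add: inner_matrix_mult_left C_def)
    moreover have "inner (mat_of W) (mat_of Y ** transpose C) = inner C C"
      by (metis calculation inner_transpose matrix_transpose_mul transpose_mat_of transpose_transpose)
    ultimately show ?thesis
      by (simp add: inner_symmat_mat_of E inner_add_right)
  qed
  ultimately show ?thesis
    by (simp add: C_def W_def Y_def)
qed

section \<open>Differentiability of the projection\<close>

lemma mat_of_sym_diag: "mat_of (sym_diag d) $ i $ j = (if i = j then d $ i else 0)"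
  by (simp add: sym_diag.rep_eq)

text \<open>The residual is diagonal with entries \<open>min (d $ i) 0\<close>: it is orthogonal to
  the positive part and meets only the diagonal of \<open>Z\<close>, which is nonnegative by testing
  \<open>Z\<close> on coordinate vectors.\<close>

lemma psd_proj_sym_diag: "psd_proj (sym_diag d) = sym_diag (\<chi> i. max (d $ i) 0)"
proof (rule closest_point_eqI[OF convex_psd_cone closed_psd_cone])
  let ?y = "\<chi> i. max (d $ i) 0"
  have "inner v (mat_of (sym_diag ?y) *v v) = (\<Sum>i\<in>UNIV. max (d $ i) 0 * (v $ i)\<^sup>2)" for v
    by (simp add: inner_vec_def matrix_vector_mult_def mat_of_sym_diag if_distrib[of "\<lambda>x. x * _"]
        power2_eq_square cong: if_cong) (simp add: mult_ac)
  then show "sym_diag ?y \<in> psd_cone"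
    by (auto simp: psd_cone_def intro: sum_nonneg)
  fix Z :: "'a symmat" assume Z: "Z \<in> psd_cone"
  have diag: "0 \<le> mat_of Z $ i $ i" for i
  proof -
    have "0 \<le> inner (axis i 1) (mat_of Z *v axis i 1)"
      using Z by (simp add: psd_cone_def)
    then show ?thesis
      by (simp add: inner_axis' matrix_vector_mult_basis column_def)
  qed
  have "inner (sym_diag d - sym_diag ?y) (Z - sym_diag ?y) =
      (\<Sum>i\<in>UNIV. \<Sum>j\<in>UNIV. if i = j then (d $ i - max (d $ i) 0) * (mat_of Z $ i $ i - max (d $ i) 0) else 0)"
    unfolding inner_symmat_sum
    by (intro sum.cong refl) (simp add: minus_symmat.rep_eq mat_of_sym_diag)
  also have "\<dots> = (\<Sum>i\<in>UNIV. (d $ i - max (d $ i) 0) * (mat_of Z $ i $ i - max (d $ i) 0))"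
    by simp
  also have "\<dots> \<le> 0"
    using diag by (intro sum_nonpos) (auto simp: max_def mult_nonpos_nonneg)
  finally show "inner (sym_diag d - sym_diag ?y) (Z - sym_diag ?y) \<le> 0" .
qed

text \<open>Entry \<open>(i, j)\<close> of the complementarity \<open>Y (Y - A) = 0\<close>, expanded around a
  diagonal matrix; the last term is quadratic in \<open>H\<close>.\<close>

lemma psd_proj_diag_increment:
  fixes d :: "real^'n::finite" and H :: "'n symmat"
  defines "E \<equiv> psd_proj (sym_diag d + H) - psd_proj (sym_diag d)"
  shows "(max (d $ i) 0 + max (- d $ j) 0) * mat_of E $ i $ j =
      max (d $ i) 0 * mat_of H $ i $ j - (mat_of E ** mat_of (E - H)) $ i $ j"
proof -
  let ?y = "\<lambda>i. max (d $ i) 0" and ?w = "\<lambda>i. max (- d $ i) 0"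
  have Y: "psd_proj (sym_diag d + H) = sym_diag (vec_lambda ?y) + E"
    by (simp add: E_def psd_proj_sym_diag)
  have W: "sym_diag (vec_lambda ?y) + E - (sym_diag d + H) = sym_diag (vec_lambda ?w) + (E - H)"
    by (rule symmat_eqI) (simp add: plus_symmat.rep_eq minus_symmat.rep_eq mat_of_sym_diag max_def)
  have "mat_of (sym_diag (vec_lambda ?w) + (E - H)) ** mat_of (sym_diag (vec_lambda ?y) + E) = 0"
    using psd_proj_complementary[of "sym_diag d + H"] by (simp add: Y W)
  \<comment> \<open>Transposing swaps the two symmetric factors, so that \<open>y\<close> acts on
    rows and \<open>w\<close> on columns.\<close>
  then have "transpose (mat_of (sym_diag (vec_lambda ?w) + (E - H)) ** mat_of (sym_diag (vec_lambda ?y) + E)) $ i $ j = 0"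
    by (simp add: transpose_def)
  then have "((mat_of (sym_diag (vec_lambda ?y)) + mat_of E) **
      (mat_of (sym_diag (vec_lambda ?w)) + mat_of (E - H))) $ i $ j = 0"
    by (simp add: matrix_transpose_mul flip: plus_symmat.rep_eq)
  moreover have "(A + B) ** (C + D) = A ** (C + D) + B ** C + B ** D" for A B C D :: "real^'n^'n"
    by (simp add: matrix_add_ldistrib matrix_add_rdistrib)
  moreover have "(mat_of (sym_diag (vec_lambda ?y)) ** M) $ i $ j = ?y i * M $ i $ j" for M
    by (simp add: matrix_matrix_mult_def mat_of_sym_diag if_distrib[of "\<lambda>x. x * _"] cong: if_cong)
  moreover have "(M ** mat_of (sym_diag (vec_lambda ?w))) $ i $ j = M $ i $ j * ?w j" for M :: "real^'n^'n"
    by (simp add: matrix_matrix_mult_def mat_of_sym_diag if_distrib[of "\<lambda>x. _ * x"] cong: if_cong)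
  ultimately have "?y i * (mat_of (sym_diag (vec_lambda ?w)) $ i $ j + mat_of (E - H) $ i $ j)
      + mat_of E $ i $ j * ?w j + (mat_of E ** mat_of (E - H)) $ i $ j = 0"
    by (simp only: vector_add_component)
  \<comment> \<open>Off the diagonal the entry is zero; on it, one of the positive and negative
    parts of \<open>d $ i\<close> is.\<close>
  moreover have "?y i * mat_of (sym_diag (vec_lambda ?w)) $ i $ j = 0"
    by (simp add: mat_of_sym_diag max_def)
  ultimately show ?thesis
    by (simp add: minus_symmat.rep_eq distrib_left distrib_right right_diff_distrib mult.commute)
qed

text \<open>Nonexpansiveness gives \<open>norm E \<le> norm H\<close>, so the product in the
  increment identity is quadratic in \<open>H\<close>; dividing by the coefficient on the left costs
  at most \<open>1 / m\<close>.\<close>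

lemma psd_proj_diag_remainder_entry:
  fixes d :: "real^'n::finite" and H :: "'n symmat"
  assumes m: "0 < m" "\<And>i. m \<le> \<bar>d $ i\<bar>"
  defines "E \<equiv> psd_proj (sym_diag d + H) - psd_proj (sym_diag d)"
  shows "\<bar>mat_of (E - hadamard_V d c H) $ i $ j\<bar> \<le> 2 * CARD('n) / m * (norm H)\<^sup>2"
proof -
  have E: "norm E \<le> norm H"
    using psd_proj_nonexpansive[of "sym_diag d + H" "sym_diag d"] by (simp add: E_def)
  have EH: "norm (E - H) \<le> 2 * norm H"
    using norm_triangle_ineq4[of E H] E by linarith
  have prod: "\<bar>(mat_of E ** mat_of (E - H)) $ i $ j\<bar> \<le> 2 * CARD('n) * (norm H)\<^sup>2" for i j
  proof -
    have "\<bar>(mat_of E ** mat_of (E - H)) $ i $ j\<bar> \<le>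
        (\<Sum>k\<in>UNIV. \<bar>mat_of E $ i $ k\<bar> * \<bar>mat_of (E - H) $ k $ j\<bar>)"
      unfolding matrix_matrix_mult_def by (simp add: abs_mult[symmetric])
    also have "\<dots> \<le> (\<Sum>k\<in>(UNIV :: 'n set). norm H * (2 * norm H))"
      by (intro sum_mono mult_mono order_trans[OF abs_mat_of_le_norm E]
          order_trans[OF abs_mat_of_le_norm EH]) auto
    finally show ?thesis
      by (simp add: power2_eq_square)
  qed
  have nz: "d $ i \<noteq> 0" for i
    using m(1) m(2)[of i] by auto
  have entry: "\<bar>mat_of (E - hadamard_V d c H) $ i $ j\<bar> \<le> 2 * CARD('n) / m * (norm H)\<^sup>2"
    if ij: "d $ i > 0 \<or> d $ j < 0" for i j
  proof -
    define s where "s = max (d $ i) 0 + max (- d $ j) 0"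
    have s: "s \<ge> m"
      using ij m(2)[of i] m(2)[of j] unfolding s_def by (auto simp: max_def)
    \<comment> \<open>The weight is the quotient of the two coefficients in the increment identity:
      1, \<open>d $ i / (d $ i - d $ j)\<close> or 0 according to the signs.\<close>
    have V: "s * V_weight d c i j = max (d $ i) 0"
      using ij nz[of i] nz[of j] s m(1) unfolding s_def
      by (auto simp: V_weight_def idx_pos_def idx_zero_def idx_neg_def max_def)
    have "s * mat_of E $ i $ j = max (d $ i) 0 * mat_of H $ i $ j - (mat_of E ** mat_of (E - H)) $ i $ j"
      unfolding s_def E_def by (rule psd_proj_diag_increment)
    then have "s * mat_of (E - hadamard_V d c H) $ i $ j = - (mat_of E ** mat_of (E - H)) $ i $ j"
      by (simp add: minus_symmat.rep_eq mat_of_hadamard_V right_diff_distrib V[symmetric])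
    then have "\<bar>s * mat_of (E - hadamard_V d c H) $ i $ j\<bar> \<le> 2 * CARD('n) * (norm H)\<^sup>2"
      using prod[of i j] by simp
    then have "s * \<bar>mat_of (E - hadamard_V d c H) $ i $ j\<bar> \<le> 2 * CARD('n) * (norm H)\<^sup>2"
      using s m(1) by (simp add: abs_mult)
    moreover have "m * \<bar>mat_of (E - hadamard_V d c H) $ i $ j\<bar> \<le> s * \<bar>mat_of (E - hadamard_V d c H) $ i $ j\<bar>"
      using s by (intro mult_right_mono) auto
    ultimately show ?thesis
      using m(1) by (simp add: field_simps)
  qed
  \<comment> \<open>If \<open>d $ i < 0 < d $ j\<close>, the factor on the left of \<open>psd_proj_diag_increment\<close> vanishes,
    but there the bound follows by symmetry.\<close>
  show ?thesis
  proof (cases "d $ i > 0 \<or> d $ j < 0")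
    case False
    then have "d $ j > 0"
      using nz[of j] by auto
    then show ?thesis
      using entry[of j i] by (subst mat_of_sym) simp
  qed (rule entry)
qed

lemma linear_hadamard_V: "linear (hadamard_V \<mu> c)"
  by (rule linearI; rule symmat_eqI)
    (simp_all add: mat_of_hadamard_V plus_symmat.rep_eq scaleR_symmat.rep_eq algebra_simps)

lemma linear_op_V: "linear (op_V P \<mu> c)"
  unfolding op_V_def
  by (intro linear_compose[unfolded o_def, OF _ linear_sym_congr]
      linear_compose[unfolded o_def, OF _ linear_hadamard_V] linear_sym_congr)

lemma has_derivative_of_quadratic_remainder:
  assumes "bounded_linear f'"
    and "\<And>h. norm (f (x + h) - f x - f' h) \<le> C * (norm h)\<^sup>2"
  shows "(f has_derivative f') (at x)"
  unfolding has_derivative_at_alt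
proof (intro conjI assms(1) allI impI)
  fix e :: real assume e: "0 < e"
  \<comment> \<open>The added 1 keeps the divisor positive whatever the sign or size of
    \<open>C\<close>.\<close>
  define r where "r = e / (\<bar>C\<bar> + 1)"
  have "norm (f y - f x - f' (y - x)) \<le> e * norm (y - x)" if y: "norm (y - x) < r" for y
  proof -
    have "norm (f y - f x - f' (y - x)) \<le> C * (norm (y - x))\<^sup>2"
      using assms(2)[of "y - x"] by simp
    also have "\<dots> \<le> (\<bar>C\<bar> + 1) * (norm (y - x))\<^sup>2"
      by (intro mult_right_mono) auto
    also have "\<dots> \<le> (\<bar>C\<bar> + 1) * (r * norm (y - x))"
      unfolding power2_eq_square using y by (intro mult_left_mono mult_right_mono) auto
    also have "\<dots> = e * norm (y - x)"
      unfolding r_def by (simp add: nonzero_eq_divide_eq)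
    finally show ?thesis .
  qed
  moreover have "r > 0"
    using e by (simp add: r_def)
  ultimately show "\<exists>r>0. \<forall>y. norm (y - x) < r \<longrightarrow> norm (f y - f x - f' (y - x)) \<le> e * norm (y - x)"
    by blast
qed

text \<open>The entrywise bounds are summed. With no zero eigenvalue every \<open>c\<close> gives
  the same operator; keeping it arbitrary lets the Jacobians carry the same \<open>c\<close> as
  their limit.\<close>

lemma psd_proj_has_derivative_diag:
  fixes d :: "real^'n::finite"
  assumes nz: "\<And>i. d $ i \<noteq> 0"
  shows "(psd_proj has_derivative hadamard_V d c) (at (sym_diag d))"
proof (rule has_derivative_of_quadratic_remainder)
  \<comment> \<open>The smallest modulus of an eigenvalue bounds all the divisors from
    below.\<close>
  define m where "m = Min (range (\<lambda>i. \<bar>d $ i\<bar>))"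
  have m: "m > 0" "m \<le> \<bar>d $ i\<bar>" for i
    using nz by (auto simp: m_def)
  show "norm (psd_proj (sym_diag d + H) - psd_proj (sym_diag d) - hadamard_V d c H) \<le>
      (\<Sum>i\<in>(UNIV::'n set). \<Sum>j\<in>(UNIV::'n set). 2 * CARD('n) / m) * (norm H)\<^sup>2" for H
    unfolding sum_distrib_right
    by (intro order_trans[OF norm_symmat_le_sum] sum_mono psd_proj_diag_remainder_entry m)
qed (simp add: linear_linear linear_hadamard_V)

lemma psd_proj_has_derivative:
  assumes P: "orthogonal_matrix P" and nz: "\<And>i. d $ i \<noteq> 0"
  shows "(psd_proj has_derivative op_V P d c) (at (sym_congr P (sym_diag d)))"
proof -
  have lin: "(sym_congr Q has_derivative sym_congr Q) (at X within S)" for Q :: "real^'a^'a" and X S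
    by (intro bounded_linear_imp_has_derivative) (simp add: linear_linear linear_sym_congr)
  \<comment> \<open>Conjugating by \<open>P\<close> moves the base point to the diagonal matrix,
    after which the chain rule applies.\<close>
  have "psd_proj = (\<lambda>X. sym_congr P (psd_proj (sym_congr (transpose P) X)))"
    by (simp add: psd_proj_sym_congr[OF P, symmetric] sym_congr_inverse[OF P])
  moreover have "((\<lambda>X. sym_congr P (psd_proj (sym_congr (transpose P) X))) has_derivative
      (\<lambda>H. sym_congr P (hadamard_V d c (sym_congr (transpose P) H)))) (at (sym_congr P (sym_diag d)))"
    by (rule has_derivative_compose[OF has_derivative_compose[OF lin] lin])
      (simp add: sym_congr_inverse[OF P] psd_proj_has_derivative_diag[OF nz])
  ultimately show ?thesis
    by (simp add: op_V_def[abs_def])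
qed

section \<open>Derivatives of the Lagrangian\<close>

lemma twice_cont_diffE:
  assumes "twice_cont_diff f"
  obtains f' :: "'a::real_normed_vector \<Rightarrow> 'a \<Rightarrow>\<^sub>L 'b::real_normed_vector" and f''
  where "\<And>x. (f has_derivative blinfun_apply (f' x)) (at x)"
    and "\<And>x. (f' has_derivative blinfun_apply (f'' x)) (at x)"
    and "\<And>x. frechet_derivative f (at x) = blinfun_apply (f' x)"
proof -
  from assms obtain f' :: "'a \<Rightarrow> 'a \<Rightarrow>\<^sub>L 'b" and f'' where
    *: "\<And>x. (f has_derivative blinfun_apply (f' x)) (at x)"
    "\<And>x. (f' has_derivative blinfun_apply (f'' x)) (at x)"
    unfolding twice_cont_diff_def by blast
  then show thesis
    using frechet_derivative_at that by metis
qed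

lemma twice_cont_diff_imp_has_derivative:
  "twice_cont_diff f \<Longrightarrow> (f has_derivative frechet_derivative f (at x)) (at x)"
  by (metis twice_cont_diffE)

lemma gradient_eq:
  fixes f :: "'a::euclidean_space \<Rightarrow> real"
  assumes "(f has_derivative f') (at x)"
  shows "gradient f x = (\<Sum>b\<in>Basis. f' b *\<^sub>R b)"
proof -
  have lin: "linear f'"
    using assms by (rule has_derivative_linear)
  have "inner h (\<Sum>b\<in>Basis. f' b *\<^sub>R b) = f' h" for h
    using linear_sum[OF lin, of "\<lambda>b. inner h b *\<^sub>R b" Basis]
    by (simp add: inner_sum_right linear_scale[OF lin] euclidean_representation mult.commute)
  then have "GDERIV f x :> (\<Sum>b\<in>Basis. f' b *\<^sub>R b)"
    using assms by (simp add: gderiv_def)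
  \<comment> \<open>\<open>gradient\<close> is a definite description, so uniqueness of the
    representing vector is required as well.\<close>
  moreover have "D = D'" if "GDERIV f x :> D" "GDERIV f x :> D'" for D D'
    using has_derivative_unique[OF that[unfolded gderiv_def]] by (metis inner_commute vector_eq_ldot)
  ultimately show ?thesis
    unfolding gradient_def by (blast intro: the_equality)
qed

text \<open>All three facts come from one coordinate formula: over \<open>Basis\<close>, the
  coefficients of the gradient and of the Hessian are affine in the multipliers.\<close>

lemma
  assumes "twice_cont_diff f" "twice_cont_diff h" "twice_cont_diff g"
  shows linear_hess_lagrangian: "linear (hess_lagrangian f h g x \<xi> \<Gamma>)"
    and hess_lagrangian_tendsto:
      "(G \<longlongrightarrow> \<Gamma>) F \<Longrightarrow> ((\<lambda>k. hess_lagrangian f h g x \<xi> (G k) d) \<longlongrightarrow> hess_lagrangian f h g x \<xi> \<Gamma> d) F"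
    and grad_lagrangian_has_derivative:
      "((\<lambda>(x, \<xi>, \<Gamma>). grad_lagrangian f h g x \<xi> \<Gamma>) has_derivative
        (\<lambda>(dx, d\<xi>, d\<Gamma>). hess_lagrangian f h g x \<xi> \<Gamma> dx + adjoint (frechet_derivative h (at x)) d\<xi> +
          adjoint (frechet_derivative g (at x)) d\<Gamma>)) (at (x, \<xi>, \<Gamma>))"
proof -
  obtain f' f'' where f: "\<And>x. (f has_derivative blinfun_apply (f' x)) (at x)"
    "\<And>x. (f' has_derivative blinfun_apply (f'' x)) (at x)"
    using assms(1) by (metis twice_cont_diffE)
  obtain h' h'' where h: "\<And>x. (h has_derivative blinfun_apply (h' x)) (at x)"
    "\<And>x. (h' has_derivative blinfun_apply (h'' x)) (at x)"
    "\<And>x. frechet_derivative h (at x) = blinfun_apply (h' x)"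
    using assms(2) by (metis twice_cont_diffE)
  obtain g' g'' where g: "\<And>x. (g has_derivative blinfun_apply (g' x)) (at x)"
    "\<And>x. (g' has_derivative blinfun_apply (g'' x)) (at x)"
    "\<And>x. frechet_derivative g (at x) = blinfun_apply (g' x)"
    using assms(3) by (metis twice_cont_diffE)
  have grad: "grad_lagrangian f h g x \<xi> \<Gamma> =
      (\<Sum>b\<in>Basis. (f' x b + inner \<xi> (h' x b) + inner \<Gamma> (g' x b)) *\<^sub>R b)" for x \<xi> \<Gamma>
    unfolding grad_lagrangian_def lagrangian_def
    by (rule gradient_eq) (auto intro!: derivative_eq_intros f h g)
  define Q where "Q \<xi> \<Gamma> dx =
      (\<Sum>b\<in>Basis. (f'' x dx b + inner \<xi> (h'' x dx b) + inner \<Gamma> (g'' x dx b)) *\<^sub>R b)" for \<xi> \<Gamma> dx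
  have d1: "((\<lambda>y. blinfun_apply (f' y) b) has_derivative (\<lambda>dx. f'' x dx b)) (at x)"
    "((\<lambda>y. blinfun_apply (h' y) b) has_derivative (\<lambda>dx. h'' x dx b)) (at x)"
    "((\<lambda>y. blinfun_apply (g' y) b) has_derivative (\<lambda>dx. g'' x dx b)) (at x)" for b
    by (auto intro!: derivative_eq_intros f h g)
  have "((\<lambda>y. grad_lagrangian f h g y \<xi> \<Gamma>) has_derivative Q \<xi> \<Gamma>) (at x)" for \<xi> \<Gamma>
    unfolding grad Q_def by (auto intro!: derivative_eq_intros f(2) h(2) g(2))
  then have Q: "hess_lagrangian f h g x \<xi> \<Gamma> = Q \<xi> \<Gamma>" and linQ: "linear (Q \<xi> \<Gamma>)" for \<xi> \<Gamma>
    unfolding hess_lagrangian_def by (metis frechet_derivative_at, metis has_derivative_linear)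
  show "linear (hess_lagrangian f h g x \<xi> \<Gamma>)"
    unfolding Q by (rule linQ)
  show "((\<lambda>k. hess_lagrangian f h g x \<xi> (G k) d) \<longlongrightarrow> hess_lagrangian f h g x \<xi> \<Gamma> d) F"
    if "(G \<longlongrightarrow> \<Gamma>) F"
    unfolding Q Q_def by (intro tendsto_intros that)
  \<comment> \<open>Writing the adjoints over \<open>Basis\<close> too lets all terms of the total
    derivative merge into one sum.\<close>
  have adj: "adjoint (blinfun_apply A) z = (\<Sum>b\<in>Basis. inner z (A b) *\<^sub>R b)"
    for A :: "'a \<Rightarrow>\<^sub>L 'x::euclidean_space" and z
    using adjoint_works[OF bounded_linear.linear[OF blinfun.bounded_linear_right], of _ A z]
    by (subst euclidean_representation[symmetric]) (simp add: inner_commute)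
  note fst = has_derivative_fst[OF has_derivative_ident]
  have d2: "((\<lambda>z. f' (fst z)) has_derivative (\<lambda>dz. f'' x (fst dz))) (at (x, \<xi>, \<Gamma>))"
    "((\<lambda>z. h' (fst z)) has_derivative (\<lambda>dz. h'' x (fst dz))) (at (x, \<xi>, \<Gamma>))"
    "((\<lambda>z. g' (fst z)) has_derivative (\<lambda>dz. g'' x (fst dz))) (at (x, \<xi>, \<Gamma>))"
    by (rule has_derivative_compose[OF fst], simp add: f(2) h(2) g(2))+
  show "((\<lambda>(x, \<xi>, \<Gamma>). grad_lagrangian f h g x \<xi> \<Gamma>) has_derivative
        (\<lambda>(dx, d\<xi>, d\<Gamma>). hess_lagrangian f h g x \<xi> \<Gamma> dx + adjoint (frechet_derivative h (at x)) d\<xi> +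
          adjoint (frechet_derivative g (at x)) d\<Gamma>)) (at (x, \<xi>, \<Gamma>))"
    unfolding Q Q_def grad h(3) g(3) adj case_prod_unfold
    by (auto intro!: derivative_eq_intros d2 simp: sum.distrib[symmetric] scaleR_add_left[symmetric]
        fun_eq_iff intro!: sum.cong)
qed

section \<open>The operators as limits of Jacobians, and their kernels\<close>

text \<open>On a finite-dimensional domain pointwise convergence of linear maps is convergence in
  operator norm, so limits may be checked on single vectors.\<close>

lemma B_subdiffI:
  fixes F :: "'a::euclidean_space \<Rightarrow> 'b::real_normed_vector"
  assumes zs: "zs \<longlonglongrightarrow> z"
    and der: "\<And>k. (F has_derivative U k) (at (zs k))"
    and lim: "\<And>v. (\<lambda>k. U k v) \<longlonglongrightarrow> V v"
    and V: "linear V"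
  shows "V \<in> B_subdiff F z"
proof -
  have U: "blinfun_apply (Blinfun (U k)) = U k" for k
    using der by (intro bounded_linear_Blinfun_apply has_derivative_bounded_linear)
  have V: "blinfun_apply (Blinfun V) = V"
    using V by (intro bounded_linear_Blinfun_apply) (simp add: linear_linear)
  have "(\<lambda>k. Blinfun (U k)) \<longlonglongrightarrow> Blinfun V"
    by (rule tendsto_componentwise1) (simp add: U V lim)
  then show ?thesis
    unfolding B_subdiff_def using zs der U V
    by (auto intro!: exI[of _ "Blinfun V"] exI[of _ zs] exI[of _ "\<lambda>k. Blinfun (U k)"])
qed

lemma linear_op_U:
  assumes "twice_cont_diff f" "twice_cont_diff h" "twice_cont_diff g"
  shows "linear (op_U f h g P \<mu> x \<xi> \<Gamma> c)"
proof -
  have h: "linear (frechet_derivative h (at x))" and g: "linear (frechet_derivative g (at x))"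
    using assms twice_cont_diff_imp_has_derivative has_derivative_linear by blast+
  note L = linear_hess_lagrangian[OF assms] h g adjoint_linear[OF h] adjoint_linear[OF g] linear_op_V
  show ?thesis
    by (rule linearI)
      (auto simp: op_U_def split_beta L[THEN linear_add] L[THEN linear_scale] algebra_simps
        simp flip: scaleR_add_right)
qed

text \<open>The point \<open>x\<close> and the frame \<open>P\<close> stay fixed; only the weights
  and the multiplier in the Hessian vary. Entrywise convergence controls the norm through the sum of
  the absolute entries.\<close>

lemma op_U_tendsto:
  assumes "twice_cont_diff f" "twice_cont_diff h" "twice_cont_diff g"
    and G: "(G \<longlongrightarrow> \<Gamma>) F"
    and w: "\<And>i j. ((\<lambda>k. V_weight (\<nu> k) a i j) \<longlongrightarrow> V_weight \<mu> c i j) F"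
  shows "((\<lambda>k. op_U f h g P (\<nu> k) x \<xi> (G k) a v) \<longlongrightarrow> op_U f h g P \<mu> x \<xi> \<Gamma> c v) F"
proof -
  have sc: "continuous_on UNIV (sym_congr P)"
    by (intro linear_continuous_on) (simp add: linear_linear linear_sym_congr)
  have "((\<lambda>k. hadamard_V (\<nu> k) a H) \<longlongrightarrow> hadamard_V \<mu> c H) F" for H
  proof (rule Lim_null[THEN iffD2], rule Lim_null_comparison)
    let ?D = "\<lambda>k. hadamard_V (\<nu> k) a H - hadamard_V \<mu> c H"
    show "\<forall>\<^sub>F k in F. norm (?D k) \<le> (\<Sum>i\<in>UNIV. \<Sum>j\<in>UNIV. \<bar>mat_of (?D k) $ i $ j\<bar>)"
      by (simp add: norm_symmat_le_sum)
    have "((\<lambda>k. mat_of (?D k) $ i $ j) \<longlongrightarrow> V_weight \<mu> c i j * mat_of H $ i $ j - V_weight \<mu> c i j * mat_of H $ i $ j) F" for i j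
      unfolding minus_symmat.rep_eq mat_of_hadamard_V vector_minus_component vec_lambda_beta
      by (intro tendsto_intros w)
    then have "((\<lambda>k. mat_of (?D k) $ i $ j) \<longlongrightarrow> 0) F" for i j
      by simp
    then show "((\<lambda>k. \<Sum>i\<in>UNIV. \<Sum>j\<in>UNIV. \<bar>mat_of (?D k) $ i $ j\<bar>) \<longlongrightarrow> 0) F"
      by (intro tendsto_null_sum tendsto_rabs_zero)
  qed
  then have "((\<lambda>k. op_V P (\<nu> k) a H) \<longlongrightarrow> op_V P \<mu> c H) F" for H
    unfolding op_V_def by (intro continuous_on_tendsto_compose[OF sc]) auto
  then show ?thesis
    unfolding op_U_def split_beta
    by (intro tendsto_intros hess_lagrangian_tendsto assms(1-3) G)
qed

text \<open>Apart from the projection all components are smooth, and the projection is taken at a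
  matrix without zero eigenvalues.\<close>

lemma kkt_residual_has_derivative:
  assumes "twice_cont_diff f" "twice_cont_diff h" "twice_cont_diff g"
    and P: "orthogonal_matrix P" and A: "g x + \<Gamma> = sym_congr P (sym_diag \<mu>)"
    and nz: "\<And>i. \<mu> $ i \<noteq> 0"
  shows "(kkt_residual f h g has_derivative op_U f h g P \<mu> x \<xi> \<Gamma> c) (at (x, \<xi>, \<Gamma>))"
proof -
  have dh: "((\<lambda>z. h (fst z)) has_derivative (\<lambda>dz. frechet_derivative h (at x) (fst dz))) (at (x, \<xi>, \<Gamma>))"
    by (rule has_derivative_compose[of fst fst, OF _ ])
      (auto intro!: derivative_eq_intros twice_cont_diff_imp_has_derivative assms)
  have dg: "((\<lambda>z. g (fst z)) has_derivative (\<lambda>dz. frechet_derivative g (at x) (fst dz))) (at (x, \<xi>, \<Gamma>))"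
    by (rule has_derivative_compose[of fst fst, OF _ ])
      (auto intro!: derivative_eq_intros twice_cont_diff_imp_has_derivative assms)
  have "((\<lambda>z. g (fst z) + snd (snd z)) has_derivative
      (\<lambda>dz. frechet_derivative g (at x) (fst dz) + snd (snd dz))) (at (x, \<xi>, \<Gamma>))"
    by (auto intro!: derivative_eq_intros dg)
  then have dp: "((\<lambda>z. psd_proj (g (fst z) + snd (snd z))) has_derivative
      (\<lambda>dz. op_V P \<mu> c (frechet_derivative g (at x) (fst dz) + snd (snd dz)))) (at (x, \<xi>, \<Gamma>))"
    by (rule has_derivative_compose) (simp add: A psd_proj_has_derivative[OF P nz])
  show ?thesis
    unfolding kkt_residual_def op_U_def split_beta
    by (intro has_derivative_Pair has_derivative_add has_derivative_minus dh dg dp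
        grad_lagrangian_has_derivative[OF assms(1-3), unfolded split_beta])
qed

lemma op_U_in_B_subdiff:
  fixes \<mu> :: "real^'n::finite" and s c :: real and g :: "'a::euclidean_space \<Rightarrow> 'n symmat"
  assumes f: "twice_cont_diff f" "twice_cont_diff h" "twice_cont_diff g"
    and P: "orthogonal_matrix P" and A: "g x + \<Gamma> = sym_congr P (sym_diag \<mu>)"
    and c: "c = 0 \<and> s = - 1 \<or> c = 1 \<and> s = 1"
  shows "op_U f h g P \<mu> x \<xi> \<Gamma> c \<in> B_subdiff (kkt_residual f h g) (x, \<xi>, \<Gamma>)"
proof -
  \<comment> \<open>Moving the zero eigenvalues to \<open>\<plusminus>1 / (k + 1)\<close> by perturbing \<open>\<Gamma>\<close> alone; the
    positive sign gives weight 1 on the \<open>\<beta>\<beta>\<close> block, the negative sign weight 0.\<close>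
  define \<epsilon> :: "nat \<Rightarrow> real" where "\<epsilon> k = s * inverse (real (Suc k))" for k
  define b :: "real^'n" where "b = (\<chi> i. if \<mu> $ i = 0 then 1 else 0)"
  define \<nu> where "\<nu> k = \<mu> + \<epsilon> k *\<^sub>R b" for k
  define G where "G k = \<Gamma> + \<epsilon> k *\<^sub>R sym_congr P (sym_diag b)" for k
  have \<epsilon>: "\<epsilon> \<longlonglongrightarrow> 0"
    unfolding \<epsilon>_def[abs_def] by (rule tendsto_mult_right_zero[OF LIMSEQ_inverse_real_of_nat])
  have \<nu>: "\<nu> k $ i = (if \<mu> $ i = 0 then \<epsilon> k else \<mu> $ i)" for k i
    by (simp add: \<nu>_def b_def)
  have G: "G \<longlonglongrightarrow> \<Gamma>"
    unfolding G_def[abs_def] by (auto intro!: tendsto_eq_intros \<epsilon>)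
  have "sym_diag (\<nu> k) = sym_diag \<mu> + \<epsilon> k *\<^sub>R sym_diag b" for k
    by (rule symmat_eqI) (simp add: \<nu>_def plus_symmat.rep_eq scaleR_symmat.rep_eq mat_of_sym_diag)
  then have AG: "g x + G k = sym_congr P (sym_diag (\<nu> k))" for k
    using A by (simp add: G_def sym_congr_add sym_congr_scaleR add.assoc[symmetric])
  have nz: "\<nu> k $ i \<noteq> 0" for k i
    using c by (auto simp: \<nu> \<epsilon>_def)
  have "(\<lambda>k. V_weight (\<nu> k) c i j) \<longlonglongrightarrow> V_weight \<mu> c i j" for i j
  proof -
    \<comment> \<open>The only weights that vary with \<open>k\<close>: for negative \<epsilon>
      those pairing \<alpha> with \<beta>, tending to 1; for positive \<epsilon> those pairing
      \<beta> with \<gamma>, tending to 0.\<close>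
    have lim: "(\<lambda>k. m / (m - \<epsilon> k)) \<longlonglongrightarrow> 1" "(\<lambda>k. \<epsilon> k / (\<epsilon> k - m)) \<longlonglongrightarrow> 0" if "m \<noteq> 0" for m
      using that by (auto intro!: tendsto_eq_intros \<epsilon>)
    from c show ?thesis
    proof
      assume c: "c = 0 \<and> s = - 1"
      then have "\<epsilon> k < 0" "\<not> \<epsilon> k > 0" "\<epsilon> k \<noteq> 0" for k
        by (simp_all add: \<epsilon>_def not_less)
      then show ?thesis
        using c lim[of "\<mu> $ i"] lim[of "\<mu> $ j"]
        by (cases "\<mu> $ i" "0::real" rule: linorder_cases; cases "\<mu> $ j" "0::real" rule: linorder_cases)
          (simp_all add: V_weight_def idx_pos_def idx_zero_def idx_neg_def \<nu>)
    next
      assume c: "c = 1 \<and> s = 1"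
      then have "\<epsilon> k > 0" "\<not> \<epsilon> k < 0" "\<epsilon> k \<noteq> 0" for k
        by (simp_all add: \<epsilon>_def not_less)
      then show ?thesis
        using c lim[of "\<mu> $ i"] lim[of "\<mu> $ j"]
        by (cases "\<mu> $ i" "0::real" rule: linorder_cases; cases "\<mu> $ j" "0::real" rule: linorder_cases)
          (simp_all add: V_weight_def idx_pos_def idx_zero_def idx_neg_def \<nu>)
    qed
  qed
  then show ?thesis
    by (intro B_subdiffI[where zs = "\<lambda>k. (x, \<xi>, G k)" and U = "\<lambda>k. op_U f h g P (\<nu> k) x \<xi> (G k) c"] tendsto_intros G
        kkt_residual_has_derivative[OF f P AG nz] op_U_tendsto f linear_op_U)
qed

section \<open>Trivial kernels and nonsingularity\<close>

lemma linear_trivial_kernel_imp_nonsingular: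
  fixes U :: "'a::euclidean_space \<Rightarrow> 'a"
  assumes "linear U" "\<And>v. U v = 0 \<Longrightarrow> v = 0"
  shows "nonsingular U"
proof -
  have "inj U"
    using assms by (simp add: linear_injective_0)
  then show ?thesis
    using linear_injective_imp_surjective[OF assms(1)] assms(1)
    by (simp add: nonsingular_def bij_def)
qed

text \<open>One argument covers both cases. On the \<beta>\<beta> block of a kernel element,
  \<open>c = 0\<close> kills the rotated derivative and \<open>c = 1\<close> the rotated multiplier;
  accordingly the \<beta>\<beta> conditions on \<open>d\<close> and \<open>B\<close> appear only for
  \<open>c = 0\<close>.\<close>

lemma op_U_nonsingular:
  fixes \<mu> :: "real^'n::finite" and g :: "'a::euclidean_space \<Rightarrow> 'n symmat"
  assumes f: "twice_cont_diff f" "twice_cont_diff h" "twice_cont_diff g"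
    and P: "orthogonal_matrix P"
    and c: "c = 0 \<or> c = 1"
    and soc: "\<And>d. \<lbrakk>d \<noteq> 0; frechet_derivative h (at x) d = 0;
      c = 0 \<Longrightarrow> block_zero (idx_zero \<mu>) (idx_zero \<mu>) (rotated_dg g P x d);
      block_zero (idx_zero \<mu>) (idx_neg \<mu>) (rotated_dg g P x d);
      block_zero (idx_neg \<mu>) (idx_neg \<mu>) (rotated_dg g P x d)\<rbrakk>
      \<Longrightarrow> second_order_form f h g P \<mu> x \<xi> \<Gamma> d > 0"
    and cq: "\<And>y Y. \<exists>d B. y = frechet_derivative h (at x) d \<and>
      Y = frechet_derivative g (at x) d + sym_congr P B \<and>
      (c = 0 \<longrightarrow> block_zero (idx_zero \<mu>) (idx_zero \<mu>) B) \<and>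
      block_zero (idx_zero \<mu>) (idx_neg \<mu>) B \<and> block_zero (idx_neg \<mu>) (idx_neg \<mu>) B"
  shows "nonsingular (op_U f h g P \<mu> x \<xi> \<Gamma> c)"
proof (rule linear_trivial_kernel_imp_nonsingular[OF linear_op_U[OF f]], clarify)
  fix d :: 'a and y :: "real^'b" and Y :: "'n symmat"
  let ?h = "frechet_derivative h (at x)" and ?g = "frechet_derivative g (at x)"
  assume "op_U f h g P \<mu> x \<xi> \<Gamma> c (d, y, Y) = 0"
  then have e1: "hess_lagrangian f h g x \<xi> \<Gamma> d + adjoint ?h y + adjoint ?g Y = 0"
    and e2: "?h d = 0" and e3: "op_V P \<mu> c (?g d + Y) = ?g d"
    by (simp_all add: op_U_def zero_prod_def)
  have lin: "linear ?h" "linear ?g"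
    using f twice_cont_diff_imp_has_derivative has_derivative_linear by blast+
  define B where "B = rotated_dg g P x d"
  define R where "R = sym_congr (transpose P) Y"
  have "hadamard_V \<mu> c (B + R) = B"
    using e3 unfolding op_V_def B_def R_def rotated_dg_def
    by (simp add: sym_congr_orthogonal_eq_iff[OF P] sym_congr_add)
  \<comment> \<open>In the eigenbasis the third kernel equation decouples into scalar ones: weight 1
    forces \<open>R\<close> to vanish, weight 0 forces \<open>B\<close> to vanish, and the weights
    \<Xi> tie them together.\<close>
  then have BR: "V_weight \<mu> c i j * (mat_of B $ i $ j + mat_of R $ i $ j) = mat_of B $ i $ j" for i j
    using arg_cong[OF mat_of_hadamard_V[of \<mu> c "B + R"], of "\<lambda>M. M $ i $ j"]
    by (simp add: plus_symmat.rep_eq)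
  have Rpos: "mat_of R $ i $ j = 0" if "\<mu> $ i > 0" "\<mu> $ j \<ge> 0" for i j
    using BR[of i j] that by (cases "\<mu> $ j = 0") (auto simp: V_weight_def idx_pos_def idx_zero_def)
  have Rneg: "mat_of R $ i $ j = - (\<mu> $ j / \<mu> $ i) * mat_of B $ i $ j" if "\<mu> $ i > 0" "\<mu> $ j < 0" for i j
    using BR[of i j] that
    by (simp add: V_weight_def idx_pos_def idx_zero_def idx_neg_def field_simps)
  have Bzero: "mat_of B $ i $ j = 0" if "\<mu> $ i \<le> 0" "\<mu> $ j < 0" for i j
    using BR[of i j] that by (simp add: V_weight_def idx_pos_def idx_zero_def)
  have B0: "mat_of B $ i $ j = 0" if "\<mu> $ i = 0" "\<mu> $ j = 0" "c = 0" for i j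
    using BR[of i j] that by (simp add: V_weight_def idx_pos_def idx_zero_def)
  have R0: "mat_of R $ i $ j = 0" if "\<mu> $ i = 0" "\<mu> $ j = 0" "c \<noteq> 0" for i j
    using BR[of i j] that c by (simp add: V_weight_def idx_pos_def idx_zero_def)
  have inner_YB: "inner Y (?g d) = inner R B"
    unfolding R_def B_def rotated_dg_def
    by (simp add: inner_sym_congr sym_congr_inverse[OF P])
  have RB: "inner R B = - 2 * (\<Sum>i\<in>idx_pos \<mu>. \<Sum>j\<in>idx_neg \<mu>. \<mu> $ j / \<mu> $ i * (mat_of B $ i $ j)\<^sup>2)"
  proof -
    \<comment> \<open>Products survive only on the \<alpha>\<gamma> block, collected in
      \<open>t\<close>, and on its mirror image, whence the factor 2.\<close>
    define t where "t i j = (if \<mu> $ i > 0 \<and> \<mu> $ j < 0 then mat_of R $ i $ j * mat_of B $ i $ j else 0)" for i j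
    have "mat_of R $ i $ j * mat_of B $ i $ j = t i j + t j i" for i j
    proof (cases "\<mu> $ i > 0 \<and> \<mu> $ j < 0 \<or> \<mu> $ j > 0 \<and> \<mu> $ i < 0")
      case True
      then show ?thesis
        using mat_of_sym[of R i j] mat_of_sym[of B i j] by (auto simp: t_def)
    next
      case False
      then have "mat_of R $ i $ j = 0 \<or> mat_of B $ i $ j = 0"
        using Rpos[of i j] Rpos[of j i] Bzero[of i j] Bzero[of j i] B0[of i j] R0[of i j]
          mat_of_sym[of R i j] mat_of_sym[of B i j]
        by (cases "\<mu> $ i" "0::real" rule: linorder_cases; cases "\<mu> $ j" "0::real" rule: linorder_cases;
            cases "c = 0") simp_all
      then show ?thesis
        using False by (auto simp: t_def)
    qed
    then have "inner R B = (\<Sum>i\<in>UNIV. \<Sum>j\<in>UNIV. t i j) + (\<Sum>i\<in>UNIV. \<Sum>j\<in>UNIV. t j i)"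
      by (simp add: inner_symmat_sum sum.distrib)
    also have "\<dots> = 2 * (\<Sum>i\<in>UNIV. \<Sum>j\<in>UNIV. t i j)"
      using sum.swap[of t UNIV UNIV] by simp
    also have "(\<Sum>i\<in>UNIV. \<Sum>j\<in>UNIV. t i j) = (\<Sum>i\<in>idx_pos \<mu>. \<Sum>j\<in>idx_neg \<mu>. mat_of R $ i $ j * mat_of B $ i $ j)"
    proof -
      have "(\<Sum>i\<in>UNIV. \<Sum>j\<in>UNIV. t i j) = (\<Sum>i\<in>idx_pos \<mu>. \<Sum>j\<in>UNIV. t i j)"
        by (rule sum.mono_neutral_right) (auto simp: t_def idx_pos_def)
      also have "\<dots> = (\<Sum>i\<in>idx_pos \<mu>. \<Sum>j\<in>idx_neg \<mu>. t i j)"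
        by (intro sum.cong refl sum.mono_neutral_right) (auto simp: t_def idx_neg_def)
      also have "\<dots> = (\<Sum>i\<in>idx_pos \<mu>. \<Sum>j\<in>idx_neg \<mu>. mat_of R $ i $ j * mat_of B $ i $ j)"
        by (intro sum.cong refl) (simp add: t_def idx_pos_def idx_neg_def)
      finally show ?thesis .
    qed
    also have "\<dots> = - (\<Sum>i\<in>idx_pos \<mu>. \<Sum>j\<in>idx_neg \<mu>. \<mu> $ j / \<mu> $ i * (mat_of B $ i $ j)\<^sup>2)"
      unfolding sum_negf[symmetric]
      by (intro sum.cong refl) (simp add: Rneg idx_pos_def idx_neg_def power2_eq_square)
    finally show ?thesis by simp
  qed
  have adj: "inner v (adjoint ?h y) = inner (?h v) y" "inner v (adjoint ?g Y) = inner (?g v) Y" for v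
    using lin by (simp_all add: adjoint_works)
  \<comment> \<open>Pairing the first kernel equation with \<open>d\<close>: the \<open>y\<close>
    term drops out by \<open>e2\<close>, and the \<open>Y\<close> term is \<open>inner R B\<close>,
    exactly the curvature term of the second order form.\<close>
  have "0 = inner d (hess_lagrangian f h g x \<xi> \<Gamma> d + adjoint ?h y + adjoint ?g Y)"
    by (simp add: e1)
  also have "\<dots> = second_order_form f h g P \<mu> x \<xi> \<Gamma> d"
    unfolding second_order_form_def inner_add_right adj
    using RB inner_YB by (simp add: e2 B_def inner_commute)
  finally have "\<not> second_order_form f h g P \<mu> x \<xi> \<Gamma> d > 0"
    by simp
  then have d: "d = 0"
    using soc[of d] e2 B0 Bzero
    by (auto simp: block_zero_def idx_zero_def idx_neg_def B_def)
  have B: "B = 0"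
    by (simp add: d B_def rotated_dg_def linear_0[OF lin(2)] linear_0[OF linear_sym_congr])
  have e4: "adjoint ?h y + adjoint ?g Y = 0"
    using e1 linear_0[OF linear_hess_lagrangian[OF f]] by (simp add: d)
  obtain v C where v: "y = ?h v" "Y = ?g v + sym_congr P C"
    "c = 0 \<longrightarrow> block_zero (idx_zero \<mu>) (idx_zero \<mu>) C"
    "block_zero (idx_zero \<mu>) (idx_neg \<mu>) C" "block_zero (idx_neg \<mu>) (idx_neg \<mu>) C"
    using cq[of y Y] by blast
  have C0: "mat_of C $ i $ j = 0" if "\<mu> $ i \<le> 0" "\<mu> $ j < 0" for i j
    using v(4,5) that unfolding block_zero_def idx_zero_def idx_neg_def
    by (cases "\<mu> $ i = 0") auto
  \<comment> \<open>Now \<open>B = 0\<close> removes the \<alpha>\<gamma> block of \<open>R\<close>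
    as well, leaving \<open>R\<close> supported where \<open>C\<close> vanishes.\<close>
  have "mat_of R $ i $ j = 0 \<or> mat_of C $ i $ j = 0" for i j
  proof (cases "\<mu> $ i = 0 \<and> \<mu> $ j = 0")
    case True
    then show ?thesis
      using R0[of i j] v(3) by (cases "c = 0") (auto simp: block_zero_def idx_zero_def)
  next
    case False
    then show ?thesis
      using C0[of i j] C0[of j i] Rpos[of i j] Rpos[of j i] Rneg[of i j] Rneg[of j i]
        mat_of_sym[of R i j] mat_of_sym[of C i j]
      by (cases "\<mu> $ i" "0::real" rule: linorder_cases; cases "\<mu> $ j" "0::real" rule: linorder_cases)
        (simp_all add: B zero_symmat.rep_eq)
  qed
  then have RC: "inner R C = 0"
    unfolding inner_symmat_sum by (intro sum.neutral ballI) simp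
  \<comment> \<open>Only the first arguments are decomposed; the part along \<open>v\<close> is then
    paired with the left side of \<open>e4\<close>.\<close>
  have "inner y y + inner Y Y = inner v (adjoint ?h y + adjoint ?g Y) + inner (sym_congr P C) Y"
    unfolding inner_add_right adj by (subst (1 3) v) (simp add: inner_add_left v(1))
  also have "\<dots> = 0"
    using RC by (simp add: e4 inner_sym_congr[of P C] R_def inner_commute[of C])
  finally have "y = 0" "Y = 0"
    using inner_ge_zero[of y] inner_ge_zero[of Y] by (simp_all add: add_nonneg_eq_0_iff)
  then show "(d, y, Y) = 0"
    by (simp add: d zero_prod_def)
qed

theorem theorem1:
  fixes f :: "'a::euclidean_space \<Rightarrow> real"
    and h :: "'a \<Rightarrow> real^'m"
    and g :: "'a \<Rightarrow> 'n::{finite,linorder} symmat"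
    and P :: "real^'n::_^'n::_" and \<mu> :: "real^'n::_"
    and x :: 'a and \<xi> :: "real^'m" and \<Gamma> :: "'n symmat"
  assumes "twice_cont_diff f" and "twice_cont_diff h" and "twice_cont_diff g"
    and "stationary f h g x" and "(\<xi>, \<Gamma>) \<in> multipliers f h g x"
    and "spectral_decomp P \<mu> (g x + \<Gamma>)"
  shows "(U_0 f h g P \<mu> x \<xi> \<Gamma> \<in> B_subdiff (kkt_residual f h g) (x, \<xi>, \<Gamma>) \<and>
            (W_SOC f h g P \<mu> x \<xi> \<Gamma> \<and> constraint_nondegenerate h g P \<mu> x \<longrightarrow>
               nonsingular (U_0 f h g P \<mu> x \<xi> \<Gamma>))) \<and>
         (U_I f h g P \<mu> x \<xi> \<Gamma> \<in> B_subdiff (kkt_residual f h g) (x, \<xi>, \<Gamma>) \<and>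
            (S_SOSC f h g P \<mu> x \<xi> \<Gamma> \<and> W_SRCQ h g P \<mu> x \<longrightarrow>
               nonsingular (U_I f h g P \<mu> x \<xi> \<Gamma>)))"
proof -
  have P: "orthogonal_matrix P" and A: "g x + \<Gamma> = sym_congr P (sym_diag \<mu>)"
    using assms(6) by (simp_all add: spectral_decomp_def)
  have "nonsingular (op_U f h g P \<mu> x \<xi> \<Gamma> 0)"
    if soc: "W_SOC f h g P \<mu> x \<xi> \<Gamma>" and cq: "constraint_nondegenerate h g P \<mu> x"
  proof (rule op_U_nonsingular[OF assms(1-3) P])
    fix y :: "real^'m" and Y :: "'n symmat"
    \<comment> \<open>Replacing \<open>UNIV\<close> by the sum of subspaces turns this membership
      into the required decomposition.\<close>
    have "(y, Y) \<in> UNIV" by simp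
    then show "\<exists>d B. y = frechet_derivative h (at x) d \<and>
      Y = frechet_derivative g (at x) d + sym_congr P B \<and>
      ((0::real) = 0 \<longrightarrow> block_zero (idx_zero \<mu>) (idx_zero \<mu>) B) \<and>
      block_zero (idx_zero \<mu>) (idx_neg \<mu>) B \<and> block_zero (idx_neg \<mu>) (idx_neg \<mu>) B"
      unfolding cq[unfolded constraint_nondegenerate_def, symmetric] by auto
  qed (use soc in \<open>simp_all add: W_SOC_def\<close>)
  moreover have "nonsingular (op_U f h g P \<mu> x \<xi> \<Gamma> 1)"
    if soc: "S_SOSC f h g P \<mu> x \<xi> \<Gamma>" and cq: "W_SRCQ h g P \<mu> x"
  proof (rule op_U_nonsingular[OF assms(1-3) P])
    fix y :: "real^'m" and Y :: "'n symmat"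
    have "(y, Y) \<in> UNIV" by simp
    then show "\<exists>d B. y = frechet_derivative h (at x) d \<and>
      Y = frechet_derivative g (at x) d + sym_congr P B \<and>
      ((1::real) = 0 \<longrightarrow> block_zero (idx_zero \<mu>) (idx_zero \<mu>) B) \<and>
      block_zero (idx_zero \<mu>) (idx_neg \<mu>) B \<and> block_zero (idx_neg \<mu>) (idx_neg \<mu>) B"
      unfolding cq[unfolded W_SRCQ_def, symmetric] by auto
  qed (use soc in \<open>simp_all add: S_SOSC_def\<close>)
  ultimately show ?thesis
    using op_U_in_B_subdiff[OF assms(1-3) P A, of 0 "- 1"] op_U_in_B_subdiff[OF assms(1-3) P A, of 1 1]
    by (simp add: U_0_def U_I_def)
qed

end
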